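(* Let $m\ge1$ be an integer, $\beta>0$, and let $p,q$ be real numbers with $\min(p,q)>(m-1)+1/\beta$. Let $\phi=(\phi_1,\dots,\phi_m)$ be the unique strong solution, for all $t\ge 0$, with values in $\{0\le\phi_m\le\cdots\le\phi_1\le\pi/2\}$, of $$d\phi_i(t) = d\nu_i(t) + \Big[k_0\cot \phi_i(t) + k_1\cot 2\phi_i(t) + k_2\sum_{j\neq i}\big(\cot(\phi_i(t)+\phi_j(t))+\cot(\phi_i(t)-\phi_j(t))\big)\Big]dt,\quad 1\le i\le m,$$ where $k_0=\beta(p-q)/2$, $k_1=\beta(q-(m-1))-1$, $k_2=\beta/2$. Then: (1) If $0<\beta<1$ (equivalently $0<k_2<1/2$), then $T_{\alpha}<\infty$ almost surely for every $\alpha\in\{e_i-e_{i+1}:\ 1\le i\le m-1\}$. (2) If $0<p-(m-1)<2/\beta$ (equivalently $0<2k_0+k_1+1<2$), then $T_{e_m}<\infty$ almost surely. (3) If $0<q-(m-1)<2/\beta$, then $T_{\tilde\alpha}=T_{2e_1}<\infty$ almost surely.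
   Context: $\nu=(\nu_1,\dots,\nu_m)$ is a standard $m$-dimensional Brownian motion, $(e_i)_{i=1}^m$ is the canonical basis of $\mathbb{R}^m$ and $\langle\cdot,\cdot\rangle$ is the Euclidean inner product. For $\alpha\in\{e_i-e_{i+1}: 1\le i\le m-1\}\cup\{e_m\}$ (the simple roots of type $BC_m$), $T_\alpha:=\inf\{t>0:\ \langle\alpha,\phi(t)\rangle=0\}$. For the highest root $\tilde\alpha=2e_1$, $T_{\tilde\alpha}=T_{2e_1}:=\inf\{t>0:\ \langle\tilde\alpha,\phi(t)\rangle=2\phi_1(t)=\pi\}$. Under the assumption $\min(p,q)>(m-1)+1/\beta$ the stochastic differential equation $$d\phi_i(t) = d\nu_i(t) + \Big[k_0\cot \phi_i(t) + k_1\cot 2\phi_i(t) + k_2\sum_{j\neq i}\big(\cot(\phi_i(t)+\phi_j(t))+\cot(\phi_i(t)-\phi_j(t))\big)\Big]dt,\quad 1\le i\le m,$$ with $k_0=\beta(p-q)/2$, $k_1=\beta(q-(m-1))-1$, $k_2=\beta/2$, has a unique strong solution for all time, for any starting point in $\{0\le\phi_m\le\cdots\le\phi_1\le\pi/2\}$. *)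

theory Defs
  imports "HOL-Probability.Probability"
begin

text \<open>
  A vector of \<open>\<real>\<^sup>m\<close> is a function \<open>nat \<Rightarrow> real\<close> of which only the values at the indices \<open>1, \<dots>, m\<close>
  matter. An \<open>m\<close>-dimensional process has type \<open>real \<Rightarrow> 'w \<Rightarrow> (nat \<Rightarrow> real)\<close>; only times \<open>t \<ge> 0\<close>
  matter.
\<close>

definition euclid_inner :: "nat \<Rightarrow> (nat \<Rightarrow> real) \<Rightarrow> (nat \<Rightarrow> real) \<Rightarrow> real" where
  "euclid_inner m x y = (\<Sum>i=1..m. x i * y i)"

definition unit_vec :: "nat \<Rightarrow> nat \<Rightarrow> real" where
  "unit_vec i = (\<lambda>j. if j = i then 1 else 0)"

definition closed_alcove :: "nat \<Rightarrow> (nat \<Rightarrow> real) set" where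
  "closed_alcove m = {y. (\<forall>i\<in>{1..m}. 0 \<le> y i \<and> y i \<le> pi / 2) \<and>
                         (\<forall>i\<in>{1..m}. \<forall>j\<in>{1..m}. i \<le> j \<longrightarrow> y j \<le> y i)}"

text \<open>
  In the third clause the coordinates and the successive increments are jointly independent.
\<close>

definition std_brownian_motion :: "'w measure \<Rightarrow> nat \<Rightarrow> (real \<Rightarrow> 'w \<Rightarrow> nat \<Rightarrow> real) \<Rightarrow> bool" where
  "std_brownian_motion M m \<nu> \<longleftrightarrow>
     prob_space M \<and>
     (\<forall>t\<ge>0. \<forall>i\<in>{1..m}. (\<lambda>\<omega>. \<nu> t \<omega> i) \<in> borel_measurable M) \<and>
     (\<forall>n \<tau>. 0 \<le> \<tau> 0 \<and> (\<forall>k<n. \<tau> k \<le> \<tau> (Suc k)) \<longrightarrow>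
        prob_space.indep_vars M (\<lambda>_. borel)
          (\<lambda>(i, k) \<omega>. \<nu> (\<tau> (Suc k)) \<omega> i - \<nu> (\<tau> k) \<omega> i) ({1..m} \<times> {..<n})) \<and>
     (\<forall>i\<in>{1..m}. \<forall>s\<ge>0. \<forall>t>s.
        distributed M lborel (\<lambda>\<omega>. \<nu> t \<omega> i - \<nu> s \<omega> i) (normal_density 0 (sqrt (t - s)))) \<and>
     (AE \<omega> in M. \<forall>i\<in>{1..m}. \<nu> 0 \<omega> i = 0) \<and>
     (AE \<omega> in M. \<forall>i\<in>{1..m}. continuous_on {0..} (\<lambda>t. \<nu> t \<omega> i))"

text \<open>
  The natural filtration of the driving motion, augmented by the null sets.
\<close>

definition augmented_filtration ::
    "'w measure \<Rightarrow> nat \<Rightarrow> (real \<Rightarrow> 'w \<Rightarrow> nat \<Rightarrow> real) \<Rightarrow> real \<Rightarrow> 'w measure" where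
  "augmented_filtration M m \<nu> t =
     sigma (space M)
       ({(\<lambda>\<omega>. \<nu> s \<omega> i) -` B \<inter> space M | s i B. 0 \<le> s \<and> s \<le> t \<and> i \<in> {1..m} \<and> B \<in> sets borel}
        \<union> null_sets M)"

definition jacobi_drift ::
    "nat \<Rightarrow> real \<Rightarrow> real \<Rightarrow> real \<Rightarrow> (nat \<Rightarrow> real) \<Rightarrow> nat \<Rightarrow> real" where
  "jacobi_drift m k\<^sub>0 k\<^sub>1 k\<^sub>2 y i =
     k\<^sub>0 * cot (y i) + k\<^sub>1 * cot (2 * y i) +
     k\<^sub>2 * (\<Sum>j\<in>{1..m} - {i}. cot (y i + y j) + cot (y i - y j))"

text \<open>
  \<open>cot\<close> is total in HOL, with value \<open>0\<close> at its poles. The next predicate says that no cotangent in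
  the drift is evaluated at a pole.
\<close>

definition drift_finite :: "nat \<Rightarrow> (nat \<Rightarrow> real) \<Rightarrow> bool" where
  "drift_finite m y \<longleftrightarrow>
     (\<forall>i\<in>{1..m}. sin (y i) \<noteq> 0 \<and> sin (2 * y i) \<noteq> 0 \<and>
        (\<forall>j\<in>{1..m} - {i}. sin (y i + y j) \<noteq> 0 \<and> sin (y i - y j) \<noteq> 0))"

text \<open>
  A strong solution, started at the point \<open>x\<close> and with values in the closed alcove. The noise is
  additive, so the stochastic differential equation is an integral equation along each path.
  The process may touch the poles of the drift; as usual, the drift along a path has to be finite
  for almost every time and integrable on bounded intervals.
\<close>

definition jacobi_strong_solution ::
    "'w measure \<Rightarrow> nat \<Rightarrow> real \<Rightarrow> real \<Rightarrow> real \<Rightarrow> (real \<Rightarrow> 'w \<Rightarrow> nat \<Rightarrow> real) \<Rightarrow> (nat \<Rightarrow> real) \<Rightarrow>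
     (real \<Rightarrow> 'w \<Rightarrow> nat \<Rightarrow> real) \<Rightarrow> bool" where
  "jacobi_strong_solution M m k\<^sub>0 k\<^sub>1 k\<^sub>2 \<nu> x \<phi> \<longleftrightarrow>
     (\<forall>t\<ge>0. \<forall>i\<in>{1..m}. (\<lambda>\<omega>. \<phi> t \<omega> i) \<in> borel_measurable (augmented_filtration M m \<nu> t)) \<and>
     (AE \<omega> in M. \<forall>i\<in>{1..m}. continuous_on {0..} (\<lambda>t. \<phi> t \<omega> i)) \<and>
     (AE \<omega> in M. \<forall>t\<ge>0. \<phi> t \<omega> \<in> closed_alcove m) \<and>
     (AE \<omega> in M. AE s in lborel. 0 \<le> s \<longrightarrow> drift_finite m (\<phi> s \<omega>)) \<and>
     (AE \<omega> in M. \<forall>t\<ge>0. \<forall>i\<in>{1..m}.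
        set_integrable lborel {0..t} (\<lambda>s. jacobi_drift m k\<^sub>0 k\<^sub>1 k\<^sub>2 (\<phi> s \<omega>) i) \<and>
        \<phi> t \<omega> i = x i + \<nu> t \<omega> i + (LBINT s:{0..t}. jacobi_drift m k\<^sub>0 k\<^sub>1 k\<^sub>2 (\<phi> s \<omega>) i))"

text \<open>
  First strictly positive time at which \<open>\<langle>\<alpha>, \<phi>(t)\<rangle> = c\<close>; it is \<open>\<infinity>\<close> if there is no such time.
\<close>

definition hitting_time ::
    "nat \<Rightarrow> (real \<Rightarrow> 'w \<Rightarrow> nat \<Rightarrow> real) \<Rightarrow> (nat \<Rightarrow> real) \<Rightarrow> real \<Rightarrow> 'w \<Rightarrow> ereal" where
  "hitting_time m \<phi> \<alpha> c \<omega> = (INF t\<in>{t. 0 < t \<and> euclid_inner m \<alpha> (\<phi> t \<omega>) = c}. ereal t)"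

abbreviation root_hitting_time ::
    "nat \<Rightarrow> (real \<Rightarrow> 'w \<Rightarrow> nat \<Rightarrow> real) \<Rightarrow> (nat \<Rightarrow> real) \<Rightarrow> 'w \<Rightarrow> ereal" where
  "root_hitting_time m \<phi> \<alpha> \<equiv> hitting_time m \<phi> \<alpha> 0"

abbreviation highest_root_hitting_time ::
    "nat \<Rightarrow> (real \<Rightarrow> 'w \<Rightarrow> nat \<Rightarrow> real) \<Rightarrow> 'w \<Rightarrow> ereal" where
  "highest_root_hitting_time m \<phi> \<equiv> hitting_time m \<phi> (\<lambda>j. 2 * unit_vec 1 j) pi"

end

theory Submission
  imports Defs
begin

text \<open>
  Each of the hitting times in question is the first zero of a process \<open>Y = c\<^sub>0 + \<Sum>\<^sub>i a\<^sub>i \<phi>\<^sub>i\<close> with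
  values in \<open>[0, \<pi>/2]\<close> (\<open>Y = \<phi>\<^sub>i - \<phi>\<^sub>i\<^sub>+\<^sub>1\<close>, \<open>\<phi>\<^sub>m\<close> or \<open>\<pi>/2 - \<phi>\<^sub>1\<close>). The cotangents of all the other roots push
  \<open>Y\<close> towards \<open>0\<close>, so its drift is at most \<open>K / Y\<close> with \<open>2 K < \<sigma>\<^sup>2\<close>, where \<open>\<sigma>\<^sup>2\<close> is the variance of
  the driving Brownian motion \<open>W\<close>. For small \<open>\<theta> > 0\<close> the function \<open>y powr \<theta>\<close> is then a bounded
  strict supersolution of the Bessel generator.

  Stochastic calculus is avoided by discretization. On a path with \<open>Y > 0\<close> on \<open>[1, 1 + T]\<close>, uniform
  continuity gives \<open>Y\<^sub>t\<^sub>+\<^sub>h \<le> Y\<^sub>t + (W\<^sub>t\<^sub>+\<^sub>h - W\<^sub>t) + h K' / Y\<^sub>t\<close> for a slightly larger \<open>K'\<close> and every small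
  step \<open>h\<close>. On the event that this holds along a grid of mesh \<open>h\<close> and that \<open>Y \<ge> \<epsilon>\<close> there, each step
  decreases the mean of \<open>Y powr \<theta>\<close> by a fixed multiple of \<open>h\<close> times the probability of the event;
  hence this probability is \<open>O(1/T)\<close>, uniformly in \<open>\<epsilon>\<close> and small \<open>h\<close>. Letting \<open>h \<rightarrow> 0\<close>, \<open>\<epsilon> \<rightarrow> 0\<close> and
  \<open>T \<rightarrow> \<infinity>\<close> shows that \<open>Y\<close> reaches \<open>0\<close> almost surely.
\<close>

section \<open>Taylor bounds for the Lyapunov function\<close>

text \<open>For \<open>u \<ge> -1/2\<close> this is Taylor's formula at 1: the third derivative is
  at most 16 in absolute value on \<open>[1/2, \<infinity>)\<close>, and the factor 1/6 is given
  away. For \<open>u < -1/2\<close> the left side is at most 1, while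
  \<open>16 * \<bar>u\<bar> ^ 3 \<ge> 2\<close> outweighs the linear loss (at most 1) and the
  quadratic loss (at most 1/2).\<close>

lemma powr_le_cubic:
  fixes \<theta> u :: real
  assumes "0 < \<theta>" "\<theta> < 1" "-1 \<le> u"
  shows "(1 + u) powr \<theta> \<le> 1 + \<theta> * u - \<theta> * (1 - \<theta>) / 2 * u\<^sup>2 + 16 * \<bar>u\<bar> ^ 3"
proof (cases "u < -1/2")
  case True
  have "(1 + u) powr \<theta> \<le> 1"
    using assms powr_mono2[of \<theta> "1 + u" 1] True by auto
  moreover have "\<bar>u\<bar> ^ 3 \<ge> (1/2) ^ 3"
    using True by (intro power_mono) auto
  moreover have "\<theta> * u \<ge> - 1"
    using mult_mono[of \<theta> 1 "-u" 1] assms True by auto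
  moreover have "\<theta> * (1 - \<theta>) / 2 * u\<^sup>2 \<le> 1/2"
  proof -
    have "u\<^sup>2 \<le> 1"
      using assms True by (simp add: power_le_one_iff abs_square_le_1 abs_le_iff)
    moreover have "\<theta> * (1 - \<theta>) \<le> 1"
      using assms mult_mono[of \<theta> 1 "1 - \<theta>" 1] by auto
    ultimately show ?thesis
      using mult_mono[of "\<theta> * (1 - \<theta>)" 1 "u\<^sup>2" 1] assms by auto
  qed
  ultimately show ?thesis by (simp add: power3_eq_cube)
next
  case False
  show ?thesis
  proof (cases "u = 0")
    case True then show ?thesis by simp
  next
    case un: False
    define d where "d = (\<lambda>n::nat. \<lambda>x::real. if n = 0 then x powr \<theta> else if n = 1 then \<theta> * x powr (\<theta> - 1)
       else if n = 2 then \<theta> * (\<theta> - 1) * x powr (\<theta> - 2) else \<theta> * (\<theta> - 1) * (\<theta> - 2) * x powr (\<theta> - 3))"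
    have der: "DERIV (d k) x :> d (Suc k) x" if "k < 3" "1/2 \<le> x" for k x
    proof -
      have "k = 0 \<or> k = 1 \<or> k = 2" using that by linarith
      then show ?thesis
        by (elim disjE) (use that in \<open>auto simp: d_def numeral_eq_Suc intro!: derivative_eq_intros\<close>)
    qed
    have "\<exists>t. (if 1 + u < 1 then 1 + u < t \<and> t < 1 else 1 < t \<and> t < 1 + u) \<and>
        (1 + u) powr \<theta> = (\<Sum>k<3. d k 1 / fact k * (1 + u - 1) ^ k) + d 3 t / fact 3 * (1 + u - 1) ^ 3"
      using un False by (intro Taylor[where a = "1/2" and b = "2 + u"] allI impI der) (auto simp: d_def)
    then obtain t where ift: "if 1 + u < 1 then 1 + u < t \<and> t < 1 else 1 < t \<and> t < 1 + u" and
      eq: "(1 + u) powr \<theta> = (\<Sum>k<3. d k 1 / fact k * u ^ k) + d 3 t / fact 3 * u ^ 3"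
      by auto
    have t: "1/2 \<le> t" using ift False by (simp split: if_splits)
    have "\<bar>d 3 t\<bar> \<le> 2 * 8"
    proof -
      have "t powr (\<theta> - 3) \<le> (1/2) powr (\<theta> - 3)"
        using t assms by (intro powr_mono2') auto
      also have "\<dots> \<le> (1/2) powr (-3)"
        using assms by (intro powr_mono') auto
      also have "\<dots> = 8" by (simp add: powr_minus powr_numeral power_divide)
      finally have 1: "t powr (\<theta> - 3) \<le> 8" .
      have "\<bar>\<theta> * (\<theta> - 1)\<bar> \<le> 1 * 1" unfolding abs_mult using assms by (intro mult_mono) auto
      then have "\<bar>\<theta> * (\<theta> - 1) * (\<theta> - 2)\<bar> \<le> 1 * 2"
        unfolding abs_mult[of _ "\<theta> - 2"] using assms by (intro mult_mono) auto
      then have "\<bar>\<theta> * (\<theta> - 1) * (\<theta> - 2) * t powr (\<theta> - 3)\<bar> \<le> 2 * 8"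
        unfolding abs_mult[of _ "t powr (\<theta> - 3)"] using 1 by (intro mult_mono) auto
      then show ?thesis by (simp add: d_def)
    qed
    then have "\<bar>d 3 t\<bar> * \<bar>u ^ 3\<bar> \<le> 16 * \<bar>u ^ 3\<bar>"
      by (intro mult_right_mono) auto
    moreover have "d 3 t * u ^ 3 \<le> \<bar>d 3 t\<bar> * \<bar>u ^ 3\<bar>"
      by (metis abs_ge_self abs_mult)
    moreover have "0 \<le> \<bar>u\<bar> ^ 3" "\<bar>u ^ 3\<bar> = \<bar>u\<bar> ^ 3" by (simp_all add: power_abs)
    moreover have "d 3 t / fact 3 * u ^ 3 = d 3 t * u ^ 3 / 6" by (simp add: fact_numeral)
    ultimately have "d 3 t / fact 3 * u ^ 3 \<le> 16 * \<bar>u\<bar> ^ 3" by linarith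
    moreover have "(\<Sum>k<3. d k 1 / fact k * u ^ k) = 1 + \<theta> * u - \<theta> * (1 - \<theta>) / 2 * u\<^sup>2"
      by (simp add: d_def numeral_eq_Suc algebra_simps diff_divide_distrib)
    ultimately show ?thesis using eq by linarith
  qed
qed

text \<open>The cubic term is split by AM-GM, so that only even Gaussian moments beyond the first are needed.\<close>

lemma powr_le_quartic:
  fixes \<theta> u :: real
  assumes "0 < \<theta>" "\<theta> < 1/2"
  defines "R \<equiv> 1 + \<theta> * u - (\<theta> * (1 - \<theta>) / 2 - \<theta>\<^sup>2 / 4) * u\<^sup>2 + 256 / \<theta>\<^sup>2 * u ^ 4"
  shows "0 \<le> R" and "-1 \<le> u \<Longrightarrow> (1 + u) powr \<theta> \<le> R"
proof -
  have "0 \<le> (\<theta> / 2 * \<bar>u\<bar> - 16 / \<theta> * u\<^sup>2)\<^sup>2" by simp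
  also have "\<dots> = \<theta>\<^sup>2 / 4 * u\<^sup>2 + 256 / \<theta>\<^sup>2 * u ^ 4 - 16 * \<bar>u\<bar> ^ 3"
    using assms by (simp add: power2_diff power_mult_distrib power_divide field_simps eval_nat_numeral)
  finally have amgm: "16 * \<bar>u\<bar> ^ 3 \<le> \<theta>\<^sup>2 / 4 * u\<^sup>2 + 256 / \<theta>\<^sup>2 * u ^ 4" by simp
  show A: "(1 + u) powr \<theta> \<le> R" if "-1 \<le> u"
    using powr_le_cubic[of \<theta> u] amgm that assms by (simp add: R_def algebra_simps)
  \<comment> \<open>A Gaussian increment can make \<open>u < -1\<close>, so positivity is needed
    there too. In that range \<open>\<bar>u\<bar>\<close> and its square are dominated by the cube,
    and the quartic part of \<open>R\<close> absorbs both negative terms.\<close>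
  show "0 \<le> R"
  proof (cases "-1 \<le> u")
    case True
    then show ?thesis using A[OF True] powr_ge_zero[of "1 + u" \<theta>] by linarith
  next
    case False
    then have 1: "\<bar>u\<bar> \<le> \<bar>u\<bar> ^ 3" "\<bar>u\<bar> ^ 2 \<le> \<bar>u\<bar> ^ 3"
      by (intro self_le_power power_increasing; simp)+
    have 2: "\<theta> * \<bar>u\<bar> \<le> 1 * \<bar>u\<bar>" "\<theta> * (1 - \<theta>) / 2 * \<bar>u\<bar> ^ 2 \<le> 1 * \<bar>u\<bar> ^ 2"
      using assms mult_mono[of \<theta> 1 "1 - \<theta>" 1] by (intro mult_right_mono; simp)+
    have "\<theta> * u = - (\<theta> * \<bar>u\<bar>)" using False by auto
    moreover have "R = 1 + \<theta> * u - \<theta> * (1 - \<theta>) / 2 * \<bar>u\<bar> ^ 2 + (\<theta>\<^sup>2 / 4 * u\<^sup>2 + 256 / \<theta>\<^sup>2 * u ^ 4)"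
      by (simp add: R_def algebra_simps)
    ultimately show ?thesis using 1 2 amgm by linarith
  qed
qed

section \<open>Bounds on the drift\<close>

lemma sin_ge_mult_cos:
  fixes x :: real
  assumes "0 \<le> x" "x \<le> pi"
  shows "x * cos x \<le> sin x"
proof -
  have "(\<lambda>x. sin x - x * cos x) 0 \<le> (\<lambda>x. sin x - x * cos x) x"
  proof (rule DERIV_nonneg_imp_nondecreasing[OF assms(1)])
    fix t assume "0 \<le> t" "t \<le> x"
    then show "\<exists>y. ((\<lambda>x. sin x - x * cos x) has_real_derivative y) (at t) \<and> 0 \<le> y"
      using assms by (intro exI[of _ "t * sin t"])
        (auto intro!: derivative_eq_intros mult_nonneg_nonneg sin_ge_zero)
  qed
  then show ?thesis by simp
qed

lemma cot_le_inverse: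
  fixes x :: real
  assumes "0 < x" "x < pi"
  shows "cot x \<le> 1 / x"
  using sin_ge_mult_cos[of x] assms sin_gt_zero[of x] by (simp add: cot_def field_simps)

lemma cot_diff:
  fixes x y :: real
  assumes "sin x \<noteq> 0" "sin y \<noteq> 0"
  shows "cot x - cot y = sin (y - x) / (sin x * sin y)"
  using assms by (simp add: cot_def sin_diff field_simps)

lemma cot_antimono:
  fixes x y :: real
  assumes "0 < x" "x \<le> y" "y < pi"
  shows "cot y \<le> cot x"
  using cot_diff[of x y] assms sin_gt_zero[of x] sin_gt_zero[of y] sin_ge_zero[of "y - x"]
  by (smt (verit) divide_nonneg_pos mult_pos_pos)

lemma cot_uminus: "cot (- x :: real) = - cot x"
  by (simp add: cot_def)

text \<open>Writing \<open>cot (2 * x) = (cot x - tan x) / 2\<close> separates the two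
  singularities: the pole at 0 has strength \<open>k\<^sub>0 + k\<^sub>1 / 2\<close>, the pole at
  \<open>pi / 2\<close> has strength \<open>k\<^sub>1 / 2\<close>. These are the constants that
  decide whether each wall is hit.\<close>

lemma one_particle_drift_eq:
  fixes x k\<^sub>0 k\<^sub>1 :: real
  assumes "sin x \<noteq> 0" "cos x \<noteq> 0"
  shows "k\<^sub>0 * cot x + k\<^sub>1 * cot (2 * x) = (k\<^sub>0 + k\<^sub>1 / 2) * cot x - k\<^sub>1 / 2 * tan x"
proof -
  have eq: "cot (2 * x) = (cot x - tan x) / 2"
    unfolding cot_def tan_def cos_double sin_double
    using assms by (simp add: field_simps power2_eq_square)
  show ?thesis unfolding eq by (simp add: algebra_simps diff_divide_distrib)
qed

lemma one_particle_drift_antimono: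
  fixes x y k\<^sub>0 k\<^sub>1 :: real
  assumes "0 < x" "x \<le> y" "y < pi / 2" "0 \<le> k\<^sub>1" "0 \<le> 2 * k\<^sub>0 + k\<^sub>1"
  shows "k\<^sub>0 * cot y + k\<^sub>1 * cot (2 * y) \<le> k\<^sub>0 * cot x + k\<^sub>1 * cot (2 * x)"
proof -
  have nz: "sin x \<noteq> 0" "cos x \<noteq> 0" "sin y \<noteq> 0" "cos y \<noteq> 0"
    using assms sin_gt_zero2[of x] sin_gt_zero2[of y] cos_gt_zero[of x] cos_gt_zero[of y] by auto
  have "cot y \<le> cot x" using assms by (intro cot_antimono) auto
  moreover have "tan x \<le> tan y" using assms by (intro tan_mono_le) auto
  ultimately have "(k\<^sub>0 + k\<^sub>1 / 2) * cot y \<le> (k\<^sub>0 + k\<^sub>1 / 2) * cot x" "k\<^sub>1 / 2 * tan x \<le> k\<^sub>1 / 2 * tan y"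
    using assms by (auto intro!: mult_left_mono)
  then show ?thesis using nz by (simp add: one_particle_drift_eq)
qed

text \<open>The walls of the alcove are zeros of sines listed in \<open>drift_finite\<close>, so a
  finite drift forces strict inequalities. Up to sign, all arguments of cotangents then lie in
  \<open>(0, pi)\<close>, where \<open>cot\<close> is decreasing.\<close>

lemma alcove_interior:
  assumes "y \<in> closed_alcove m" "drift_finite m y"
  shows "i \<in> {1..m} \<Longrightarrow> 0 < y i \<and> y i < pi / 2"
    and "i \<in> {1..m} \<Longrightarrow> j \<in> {1..m} \<Longrightarrow> i < j \<Longrightarrow> y j < y i"
proof -
  show "0 < y i \<and> y i < pi / 2" if "i \<in> {1..m}"
  proof -
    have "sin (y i) \<noteq> 0" "sin (2 * y i) \<noteq> 0" "0 \<le> y i" "y i \<le> pi / 2"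
      using assms that by (auto simp: closed_alcove_def drift_finite_def)
    moreover from this have "y i \<noteq> 0" "2 * y i \<noteq> pi"
      by (metis sin_zero) (use \<open>sin (2 * y i) \<noteq> 0\<close> sin_pi in metis)
    ultimately show ?thesis by linarith
  qed
  show "y j < y i" if "i \<in> {1..m}" "j \<in> {1..m}" "i < j"
  proof -
    have "y j \<le> y i" using assms that by (auto simp: closed_alcove_def)
    moreover have "sin (y i - y j) \<noteq> 0"
      using assms that by (auto simp: drift_finite_def)
    then have "y i \<noteq> y j" by auto
    ultimately show ?thesis by linarith
  qed
qed

section \<open>One-sided drift bounds at the three kinds of walls\<close>

text \<open>The one-particle drift and the interaction with any third particle are decreasing in the
  particle's own position, so they contribute at most 0 to the difference. The terms in
  \<open>y i + y (i + 1)\<close> cancel, and only the mutual repulsion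
  \<open>2 * k\<^sub>2 * cot (y i - y (i + 1))\<close> remains.\<close>

lemma drift_gap_le:
  assumes "y \<in> closed_alcove m" "drift_finite m y" "1 \<le> i" "i + 1 \<le> m"
    and "0 \<le> k\<^sub>1" "0 \<le> 2 * k\<^sub>0 + k\<^sub>1" "0 \<le> k\<^sub>2"
  shows "jacobi_drift m k\<^sub>0 k\<^sub>1 k\<^sub>2 y i - jacobi_drift m k\<^sub>0 k\<^sub>1 k\<^sub>2 y (i + 1) \<le> 2 * k\<^sub>2 / (y i - y (i + 1))"
proof -
  note int = alcove_interior[OF assms(1,2)]
  define J where "J = {1..m} - {i, i + 1}"
  have im: "i \<in> {1..m}" "i + 1 \<in> {1..m}" using assms by auto
  have D: "0 < y (i + 1)" "y (i + 1) < y i" "y i < pi / 2"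
    using int(1)[OF im(1)] int(1)[OF im(2)] int(2)[OF im] by auto
  have J: "{1..m} - {i} = insert (i + 1) J" "{1..m} - {i + 1} = insert i J" "finite J"
      "i \<notin> J" "i + 1 \<notin> J"
    using im by (auto simp: J_def)
  have "(\<Sum>j\<in>J. cot (y i + y j) + cot (y i - y j)) \<le> (\<Sum>j\<in>J. cot (y (i + 1) + y j) + cot (y (i + 1) - y j))"
  proof (intro sum_mono add_mono)
    fix j assume "j \<in> J"
    then have j: "j \<in> {1..m}" "j < i \<or> i + 1 < j" by (auto simp: J_def)
    note jb = int(1)[OF j(1)]
    show "cot (y i + y j) \<le> cot (y (i + 1) + y j)"
      using D jb by (intro cot_antimono) auto
    \<comment> \<open>No third particle lies between the two neighbours, so both differences have
      the same sign and stay on one branch of \<open>cot\<close>. The negative branch is reduced to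
      the positive one by oddness.\<close>
    from j(2) show "cot (y i - y j) \<le> cot (y (i + 1) - y j)"
    proof
      assume "j < i"
      then have "y i < y j" using int(2)[of j i] j(1) im by auto
      then have "cot (y j - y (i + 1)) \<le> cot (y j - y i)"
        using D jb by (intro cot_antimono) auto
      then show ?thesis
        using cot_uminus[of "y j - y i"] cot_uminus[of "y j - y (i + 1)"] by simp
    next
      assume "i + 1 < j"
      then have "y j < y (i + 1)" using int(2)[of "i + 1" j] j(1) im by auto
      then show ?thesis using D jb by (intro cot_antimono) auto
    qed
  qed
  then have "k\<^sub>2 * (\<Sum>j\<in>J. cot (y i + y j) + cot (y i - y j))
      \<le> k\<^sub>2 * (\<Sum>j\<in>J. cot (y (i + 1) + y j) + cot (y (i + 1) - y j))"
    using assms by (intro mult_left_mono)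
  moreover have "k\<^sub>0 * cot (y i) + k\<^sub>1 * cot (2 * y i) \<le> k\<^sub>0 * cot (y (i + 1)) + k\<^sub>1 * cot (2 * y (i + 1))"
    using D assms by (intro one_particle_drift_antimono) auto
  moreover have "k\<^sub>2 * cot (y i - y (i + 1)) \<le> k\<^sub>2 * (1 / (y i - y (i + 1)))"
    using D assms by (intro mult_left_mono cot_le_inverse) auto
  moreover have "cot (y (i + 1) - y i) = - cot (y i - y (i + 1))"
    using cot_uminus[of "y i - y (i + 1)"] by simp
  moreover have "cot (y (i + 1) + y i) = cot (y i + y (i + 1))" by (simp add: add.commute)
  ultimately show ?thesis
    using J by (simp add: jacobi_drift_def distrib_left right_diff_distrib)
qed

text \<open>Each pair term is nonpositive since \<open>y j - y m \<le> y m + y j\<close> and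
  \<open>cot\<close> is odd and decreasing on \<open>(0, pi)\<close>. The tangent part is
  nonpositive as well, which leaves the pole at 0.\<close>

lemma drift_last_le:
  assumes "y \<in> closed_alcove m" "drift_finite m y" "1 \<le> m"
    and "0 \<le> k\<^sub>1" "0 \<le> 2 * k\<^sub>0 + k\<^sub>1" "0 \<le> k\<^sub>2"
  shows "jacobi_drift m k\<^sub>0 k\<^sub>1 k\<^sub>2 y m \<le> (k\<^sub>0 + k\<^sub>1 / 2) / y m"
proof -
  note int = alcove_interior[OF assms(1,2)]
  have mm: "m \<in> {1..m}" using assms by auto
  note mb = int(1)[OF mm]
  have nz: "sin (y m) \<noteq> 0" "cos (y m) \<noteq> 0" "0 < tan (y m)"
    using mb sin_gt_zero2[of "y m"] cos_gt_zero[of "y m"] tan_gt_zero[of "y m"] by auto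
  have "(\<Sum>j\<in>{1..m} - {m}. cot (y m + y j) + cot (y m - y j)) \<le> 0"
  proof (rule sum_nonpos)
    fix j assume "j \<in> {1..m} - {m}"
    then have j: "j \<in> {1..m}" "j < m" by auto
    have "cot (y m + y j) \<le> cot (y j - y m)"
      using mb int(1)[OF j(1)] int(2)[OF j(1) mm j(2)] by (intro cot_antimono) auto
    then show "cot (y m + y j) + cot (y m - y j) \<le> 0"
      using cot_uminus[of "y j - y m"] by simp
  qed
  then have "k\<^sub>2 * (\<Sum>j\<in>{1..m} - {m}. cot (y m + y j) + cot (y m - y j)) \<le> 0"
    using assms by (intro mult_nonneg_nonpos)
  moreover have "(k\<^sub>0 + k\<^sub>1 / 2) * cot (y m) \<le> (k\<^sub>0 + k\<^sub>1 / 2) * (1 / y m)"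
    using mb assms by (intro mult_left_mono cot_le_inverse) auto
  moreover have "0 \<le> k\<^sub>1 / 2 * tan (y m)" using nz assms by simp
  ultimately show ?thesis
    using nz by (simp add: jacobi_drift_def one_particle_drift_eq)
qed

text \<open>Mirror image of the bound at 0: \<open>y 1 - y j \<le> pi - (y 1 + y j)\<close> because
  \<open>y 1 \<le> pi / 2\<close>, so every pair term is nonnegative, and \<open>tan (y 1)\<close>
  is the cotangent of the distance to \<open>pi / 2\<close>.\<close>

lemma minus_drift_first_le:
  assumes "y \<in> closed_alcove m" "drift_finite m y" "1 \<le> m"
    and "0 \<le> k\<^sub>1" "0 \<le> 2 * k\<^sub>0 + k\<^sub>1" "0 \<le> k\<^sub>2"
  shows "- jacobi_drift m k\<^sub>0 k\<^sub>1 k\<^sub>2 y 1 \<le> k\<^sub>1 / 2 / (pi / 2 - y 1)"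
proof -
  note int = alcove_interior[OF assms(1,2)]
  have mm: "1 \<in> {1..m}" using assms by auto
  note mb = int(1)[OF mm]
  have pos: "0 < sin (y 1)" "0 < cos (y 1)"
    using mb sin_gt_zero2[of "y 1"] cos_gt_zero[of "y 1"] by auto
  then have cot: "0 < cot (y 1)" by (simp add: cot_def)
  have "0 \<le> (\<Sum>j\<in>{1..m} - {1}. cot (y 1 + y j) + cot (y 1 - y j))"
  proof (rule sum_nonneg)
    fix j assume "j \<in> {1..m} - {1}"
    then have j: "j \<in> {1..m}" "1 < j" by auto
    have "cot (pi - (y 1 + y j)) \<le> cot (y 1 - y j)"
      using mb int(1)[OF j(1)] int(2)[OF mm j(1) j(2)] by (intro cot_antimono) auto
    moreover have "cot (pi - (y 1 + y j)) = - cot (y 1 + y j)"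
      unfolding cot_def sin_pi_minus cos_pi_minus by simp
    ultimately show "0 \<le> cot (y 1 + y j) + cot (y 1 - y j)" by simp
  qed
  then have "0 \<le> k\<^sub>2 * (\<Sum>j\<in>{1..m} - {1}. cot (y 1 + y j) + cot (y 1 - y j))"
    using assms by (intro mult_nonneg_nonneg)
  moreover have "k\<^sub>1 / 2 * tan (y 1) \<le> k\<^sub>1 / 2 * (1 / (pi / 2 - y 1))"
  proof (rule mult_left_mono)
    have "tan (y 1) = cot (pi / 2 - y 1)"
      using sin_cos_eq[of "y 1"] cos_sin_eq[of "y 1"] by (simp add: cot_def tan_def)
    also have "\<dots> \<le> 1 / (pi / 2 - y 1)" using mb by (intro cot_le_inverse) auto
    finally show "tan (y 1) \<le> 1 / (pi / 2 - y 1)" .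
  qed (use assms in simp)
  moreover have "0 \<le> (k\<^sub>0 + k\<^sub>1 / 2) * cot (y 1)" using cot assms by simp
  moreover have "jacobi_drift m k\<^sub>0 k\<^sub>1 k\<^sub>2 y 1 = (k\<^sub>0 + k\<^sub>1 / 2) * cot (y 1) - k\<^sub>1 / 2 * tan (y 1) +
      k\<^sub>2 * (\<Sum>j\<in>{1..m} - {1}. cot (y 1 + y j) + cot (y 1 - y j))"
    using pos by (simp add: jacobi_drift_def one_particle_drift_eq)
  moreover have "k\<^sub>1 / 2 / (pi / 2 - y 1) = k\<^sub>1 / 2 * (1 / (pi / 2 - y 1))" by simp
  ultimately show ?thesis by linarith
qed

section \<open>Processes with a singular drift\<close>

lemma (in prob_space) union_incseq_prob_le:
  assumes "range A \<subseteq> events" "incseq A" "\<And>n. prob (A n) \<le> c"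
  shows "prob (\<Union>n. A n) \<le> c"
  using LIMSEQ_le_const2[OF finite_Lim_measure_incseq[OF assms(1,2)]] assms(3) by blast

text \<open>Fatou's inequality for events: each tail intersection lies in a single
  \<open>A n\<close> with \<open>n \<ge> N\<close>, and these intersections increase to the
  union.\<close>

lemma (in prob_space) liminf_prob_le:
  assumes ev: "\<And>n::nat. A n \<in> events" and le: "\<And>n. N \<le> n \<Longrightarrow> prob (A n) \<le> c"
  shows "prob (\<Union>k. \<Inter>n\<in>{k..}. A n) \<le> c"
proof (rule union_incseq_prob_le)
  have ev': "(\<Inter>n\<in>{k..}. A n) \<in> events" for k
    by (rule sets.countable_INT') (use ev in auto)
  then show "range (\<lambda>k. \<Inter>n\<in>{k..}. A n) \<subseteq> events" by auto
  show "incseq (\<lambda>k. \<Inter>n\<in>{k..}. A n)" by (fastforce simp: incseq_def)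
  fix k
  have "prob (\<Inter>n\<in>{k..}. A n) \<le> prob (A (max N k))"
    by (intro finite_measure_mono ev) auto
  also have "\<dots> \<le> c" by (intro le) auto
  finally show "prob (\<Inter>n\<in>{k..}. A n) \<le> c" .
qed

lemma (in prob_space) normal_moments:
  assumes D: "distributed M lborel X (normal_density 0 s)" and s: "0 < s"
  shows "integrable M (\<lambda>\<omega>. X \<omega> ^ n)"
    and "expectation X = 0" "expectation (\<lambda>\<omega>. X \<omega> ^ 2) = s\<^sup>2" "expectation (\<lambda>\<omega>. X \<omega> ^ 4) = 3 * s ^ 4"
proof -
  show "integrable M (\<lambda>\<omega>. X \<omega> ^ n)"
    using distributed_integrable[OF D, of "\<lambda>x. x ^ n"] integrable_normal_moment[OF s, of 0 n] by simp
  have eq: "expectation (\<lambda>\<omega>. X \<omega> ^ n) = (\<integral>x. normal_density 0 s x * x ^ n \<partial>lborel)" for n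
    using distributed_integral[OF D, of "\<lambda>x. x ^ n"] by simp
  show "expectation X = 0"
    using eq[of 1] integral_normal_moment_odd[OF s, of 0 0] by simp
  show "expectation (\<lambda>\<omega>. X \<omega> ^ 2) = s\<^sup>2"
    using eq[of 2] integral_normal_moment_even[OF s, of 0 1] by (simp add: fact_numeral)
  show "expectation (\<lambda>\<omega>. X \<omega> ^ 4) = 3 * s ^ 4"
    using eq[of 4] integral_normal_moment_even[OF s, of 0 2] s by (simp add: fact_numeral field_simps)
qed

section \<open>The abstract one-dimensional setting\<close>

text \<open>The locale fixes only adaptedness and the Gaussian noise with variance rate
  \<open>\<sigma>\<^sup>2\<close>; how \<open>Y\<close> moves is left to the hypotheses of
  \<open>hits_zero\<close>. The parameter \<theta> measures how far the drift stays below the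
  critical strength \<open>\<sigma>\<^sup>2 / 2\<close>.\<close>

locale singular_drift_process = prob_space M for M :: "'w measure" +
  fixes F :: "real \<Rightarrow> 'w measure" and Y W :: "real \<Rightarrow> 'w \<Rightarrow> real" and \<sigma> \<theta> :: real
  assumes subalgebra: "0 \<le> t \<Longrightarrow> subalgebra M (F t)"
    and F_mono: "0 \<le> s \<Longrightarrow> s \<le> t \<Longrightarrow> sets (F s) \<subseteq> sets (F t)"
    and Y_F: "0 \<le> t \<Longrightarrow> Y t \<in> borel_measurable (F t)"
    and W_F: "0 \<le> t \<Longrightarrow> W t \<in> borel_measurable (F t)"
    and indep: "0 \<le> s \<Longrightarrow> s < t \<Longrightarrow> X \<in> borel_measurable (F s) \<Longrightarrow>
      indep_var borel X borel (\<lambda>\<omega>. W t \<omega> - W s \<omega> :: real)"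
    and normal: "0 \<le> s \<Longrightarrow> s < t \<Longrightarrow>
      distributed M lborel (\<lambda>\<omega>. W t \<omega> - W s \<omega>) (normal_density 0 (\<sigma> * sqrt (t - s)))"
    and \<sigma>: "0 < \<sigma>" and \<theta>: "0 < \<theta>" "\<theta> < 1/2"
begin

text \<open>With drift \<open>K / y\<close> the generator is
  \<open>f \<mapsto> \<sigma>\<^sup>2 / 2 * f'' + K / y * f'\<close>. For this \<open>K\<close> it
  annihilates \<open>y powr (2 * \<theta>)\<close> and maps \<open>y powr \<theta>\<close> to
  \<open>- \<sigma>\<^sup>2 * \<theta>\<^sup>2 / 2 * y powr (\<theta> - 2)\<close>, which is
  strictly negative.\<close>

definition "K = \<sigma>\<^sup>2 * (1 - 2 * \<theta>) / 2"

lemma K_pos: "0 < K" using \<sigma> \<theta> by (simp add: K_def)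

lemma space_F: "0 \<le> t \<Longrightarrow> space (F t) = space M"
  using subalgebra by (auto simp: subalgebra_def)

lemma sets_F: "0 \<le> t \<Longrightarrow> A \<in> sets (F t) \<Longrightarrow> A \<in> events"
  using subalgebra by (auto simp: subalgebra_def)

section \<open>One Euler step of the Lyapunov function\<close>

text \<open>\<open>c2\<close> is the quadratic coefficient of \<open>powr_le_quartic\<close>.
  \<open>c4\<close> is 8 times its quartic coefficient, the 8 coming from splitting a fourth power
  of noise plus drift.\<close>

definition "c2 = \<theta> * (1 - \<theta>) / 2 - \<theta>\<^sup>2 / 4"
definition "c4 = 2048 / \<theta>\<^sup>2"

lemma c2_pos: "0 < c2"
proof -
  have "\<theta> * \<theta> < \<theta> * (1 / 2)" using \<theta> by (intro mult_strict_left_mono) auto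
  then show ?thesis using \<theta> by (simp add: c2_def power2_eq_square field_simps)
qed

lemma c4_pos: "0 < c4"
  using \<theta> by (simp add: c4_def)

text \<open>\<open>g0 + g1 d + g2 d\<^sup>2 + g4 d\<^sup>4\<close> bounds the Lyapunov function \<open>y powr \<theta>\<close> after an Euler
  step of length \<open>h\<close> from \<open>y\<close> with noise increment \<open>d\<close>.\<close>

definition "g0 h y = y powr \<theta> * (1 + \<theta> * (h * K / y) / y + c4 * (h * K / y) ^ 4 / y ^ 4)"
definition "g1 h y = y powr \<theta> * (\<theta> / y - 2 * c2 * (h * K / y) / y\<^sup>2)"
definition "g2 y = - c2 * y powr \<theta> / y\<^sup>2"
definition "g4 y = c4 * y powr \<theta> / y ^ 4"

text \<open>In terms of the relative increment \<open>u = (d + e) / y\<close>, where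
  \<open>e = h * K / y\<close>, the new position is at most \<open>y * (1 + u)\<close>, so
  \<open>powr_le_quartic\<close> applies after scaling by \<open>y powr \<theta>\<close>. Dropping
  the square of \<open>e\<close> and splitting the fourth power leaves no cubic term in
  \<open>d\<close>. The bound is nonnegative for every \<open>d\<close>, so it also majorizes 0 on
  paths that leave the event in this step.\<close>

lemma euler_step:
  fixes y d h :: real
  assumes y: "0 < y"
  defines "b \<equiv> g0 h y + g1 h y * d + g2 y * d\<^sup>2 + g4 y * d ^ 4"
  shows "0 \<le> b" and "0 \<le> w \<Longrightarrow> w \<le> y + d + h * K / y \<Longrightarrow> w powr \<theta> \<le> b"
proof -
  define e u where "e = h * K / y" and "u = (d + e) / y"
  define R where "R = 1 + \<theta> * u - c2 * u\<^sup>2 + 256 / \<theta>\<^sup>2 * u ^ 4"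
  have "(d + e) ^ 4 \<le> 8 * (d ^ 4 + e ^ 4)"
  proof -
    have "(d + e)\<^sup>2 \<le> 2 * (d\<^sup>2 + e\<^sup>2)"
      using sum_squares_ge_zero[of "d - e" 0] by (simp add: power2_eq_square algebra_simps)
    then have "((d + e)\<^sup>2)\<^sup>2 \<le> (2 * (d\<^sup>2 + e\<^sup>2))\<^sup>2" by (intro power_mono) auto
    also have "\<dots> \<le> 8 * (d ^ 4 + e ^ 4)"
      using zero_le_power2[of "d\<^sup>2 - e\<^sup>2"] by (simp add: eval_nat_numeral algebra_simps)
    finally show ?thesis by (simp flip: power_mult)
  qed
  then have "256 / \<theta>\<^sup>2 * u ^ 4 \<le> 256 / \<theta>\<^sup>2 * (8 * (d ^ 4 + e ^ 4) / y ^ 4)"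
    unfolding u_def power_divide using y by (intro mult_left_mono divide_right_mono) auto
  also have "\<dots> = c4 * (d ^ 4 + e ^ 4) / y ^ 4" by (simp add: c4_def)
  finally have 4: "256 / \<theta>\<^sup>2 * u ^ 4 \<le> c4 * (d ^ 4 + e ^ 4) / y ^ 4" .
  have "c2 * ((d\<^sup>2 + 2 * d * e) / y\<^sup>2) \<le> c2 * u\<^sup>2"
    unfolding u_def power_divide using y c2_pos
    by (intro mult_left_mono divide_right_mono) (auto simp: power2_eq_square algebra_simps)
  then have "R \<le> 1 + \<theta> * (d + e) / y - c2 * ((d\<^sup>2 + 2 * d * e) / y\<^sup>2) + c4 * (d ^ 4 + e ^ 4) / y ^ 4"
    using 4 by (simp add: R_def u_def)
  then have "y powr \<theta> * R \<le> y powr \<theta> * (1 + \<theta> * (d + e) / y - c2 * ((d\<^sup>2 + 2 * d * e) / y\<^sup>2)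
      + c4 * (d ^ 4 + e ^ 4) / y ^ 4)"
    by (intro mult_left_mono) auto
  also have "\<dots> = b"
    unfolding b_def g0_def g1_def g2_def g4_def e_def[symmetric]
    by (simp add: algebra_simps add_divide_distrib)
  finally have Rb: "y powr \<theta> * R \<le> b" .
  have "0 \<le> R" unfolding R_def c2_def by (rule powr_le_quartic(1)[OF \<theta>])
  then show "0 \<le> b" using Rb by (smt (verit) mult_nonneg_nonneg powr_ge_zero)
  show "w powr \<theta> \<le> b" if "0 \<le> w" "w \<le> y + d + h * K / y"
  proof -
    have eq: "y + d + h * K / y = y * (1 + u)" using y by (simp add: u_def e_def field_simps)
    have u: "-1 \<le> u"
      using that y unfolding eq by (smt (verit) zero_le_mult_iff)
    have "w powr \<theta> \<le> (y * (1 + u)) powr \<theta>"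
      using that \<theta> eq by (intro powr_mono2) auto
    also have "\<dots> = y powr \<theta> * (1 + u) powr \<theta>" using y u by (simp add: powr_mult)
    also have "\<dots> \<le> y powr \<theta> * R"
      unfolding R_def c2_def using u \<theta> by (intro mult_left_mono powr_le_quartic(2)) auto
    finally show ?thesis using Rb by simp
  qed
qed

text \<open>The left side is the mean of the bound of \<open>euler_step\<close> for a centred
  Gaussian \<open>d\<close> of variance \<open>\<sigma>\<^sup>2 * h\<close>. Its part of order h is
  at most \<open>- \<sigma>\<^sup>2 * \<theta>\<^sup>2 / 16 * h\<close>, and half of this pays for
  the remainder of order h^2. Only \<open>h\<^sub>0\<close> depends on \<epsilon>, not the rate of
  decrease; the later limit \<epsilon> \<rightarrow> 0 rests on this.\<close>

lemma euler_step_mean: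
  fixes \<epsilon> :: real
  assumes "0 < \<epsilon>"
  shows "\<exists>h\<^sub>0>0. \<forall>h y. 0 < h \<longrightarrow> h \<le> h\<^sub>0 \<longrightarrow> \<epsilon> \<le> y \<longrightarrow> y \<le> 2 \<longrightarrow>
    g0 h y + g2 y * (\<sigma>\<^sup>2 * h) + g4 y * (3 * \<sigma> ^ 4 * h\<^sup>2) \<le> y powr \<theta> - \<sigma>\<^sup>2 * \<theta>\<^sup>2 / 32 * h"
proof -
  \<comment> \<open>\<open>C * h\<^sup>2\<close> bounds the remainder, using
    \<open>y powr \<theta> \<le> 2\<close> and \<open>h \<le> 1\<close>; the choice
    \<open>h \<le> a / C\<close> makes it at most \<open>a * h\<close>.\<close>
  define C where "C = 2 * c4 * (K ^ 4 / \<epsilon> ^ 8 + 3 * \<sigma> ^ 4 / \<epsilon> ^ 4)"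
  define a where "a = \<sigma>\<^sup>2 * \<theta>\<^sup>2 / 32"
  have C: "0 < C" using c4_pos K_pos \<sigma> assms by (auto simp: C_def intro!: mult_pos_pos add_pos_pos)
  have a: "0 < a" using \<sigma> \<theta> by (simp add: a_def)
  show ?thesis
  proof (intro exI[of _ "min 1 (a / C)"] conjI allI impI)
    show "0 < min 1 (a / C)" using C a by simp
    fix h y assume h: "0 < h" "h \<le> min 1 (a / C)" and y: "\<epsilon> \<le> y" "y \<le> 2"
    have y0: "0 < y" using assms y by simp
    define p where "p = y powr \<theta>"
    have p: "0 < p" "p \<le> 2" "1 / 4 \<le> p / y\<^sup>2"
    proof -
      show "0 < p" using y0 by (simp add: p_def)
      have "p \<le> 2 powr \<theta>" using y y0 \<theta> by (auto simp: p_def intro!: powr_mono2)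
      also have "\<dots> \<le> 2 powr 1" using \<theta> by (intro powr_mono) auto
      finally show "p \<le> 2" by simp
      \<comment> \<open>The quotient is \<open>y powr (\<theta> - 2)\<close>, decreasing in
        \<open>y\<close>, hence smallest at the upper end 2 of the range.\<close>
      have "(1 / 4 :: real) = 2 powr (-2)" by (simp add: powr_minus powr_numeral)
      also have "\<dots> \<le> 2 powr (\<theta> - 2)" using \<theta> by (intro powr_mono) auto
      also have "\<dots> \<le> y powr (\<theta> - 2)" using y y0 \<theta> by (intro powr_mono2') auto
      also have "\<dots> = p / y\<^sup>2" using y0 by (simp add: p_def powr_diff powr_numeral)
      finally show "1 / 4 \<le> p / y\<^sup>2" .
    qed
    have e1: "g0 h y + g2 y * (\<sigma>\<^sup>2 * h) + g4 y * (3 * \<sigma> ^ 4 * h\<^sup>2) =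
        p + p / y\<^sup>2 * h * (\<theta> * K - c2 * \<sigma>\<^sup>2) + p * c4 * h\<^sup>2 * (h\<^sup>2 * K ^ 4 / y ^ 8 + 3 * \<sigma> ^ 4 / y ^ 4)"
      unfolding g0_def g2_def g4_def p_def[symmetric] using y0
      by (simp add: eval_nat_numeral field_simps)
    have e2: "\<theta> * K - c2 * \<sigma>\<^sup>2 = - (\<sigma>\<^sup>2 * \<theta>\<^sup>2 / 4)"
      by (simp add: K_def c2_def eval_nat_numeral field_simps)
    have "p / y\<^sup>2 * h * (- (\<sigma>\<^sup>2 * \<theta>\<^sup>2 / 4)) \<le> - (2 * a * h)"
    proof -
      have "1 / 4 * (h * (\<sigma>\<^sup>2 * \<theta>\<^sup>2 / 4)) \<le> p / y\<^sup>2 * (h * (\<sigma>\<^sup>2 * \<theta>\<^sup>2 / 4))"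
        using p h by (intro mult_right_mono) auto
      then show ?thesis by (simp add: a_def mult_ac)
    qed
    moreover have "p * c4 * h\<^sup>2 * (h\<^sup>2 * K ^ 4 / y ^ 8 + 3 * \<sigma> ^ 4 / y ^ 4) \<le> a * h"
    proof -
      have "h\<^sup>2 * K ^ 4 / y ^ 8 \<le> 1 * K ^ 4 / \<epsilon> ^ 8"
        using h y assms by (intro frac_le mult_right_mono power_mono) (auto simp: power_le_one)
      moreover have "3 * \<sigma> ^ 4 / y ^ 4 \<le> 3 * \<sigma> ^ 4 / \<epsilon> ^ 4"
        using y assms by (intro frac_le power_mono) auto
      ultimately have "p * c4 * h\<^sup>2 * (h\<^sup>2 * K ^ 4 / y ^ 8 + 3 * \<sigma> ^ 4 / y ^ 4)
          \<le> 2 * c4 * h\<^sup>2 * (K ^ 4 / \<epsilon> ^ 8 + 3 * \<sigma> ^ 4 / \<epsilon> ^ 4)"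
        using p c4_pos y0 by (intro mult_mono) auto
      also have "\<dots> = (C * h) * h" by (simp add: C_def power2_eq_square)
      also have "\<dots> \<le> a * h" using h C by (intro mult_right_mono) (auto simp: field_simps)
      finally show ?thesis .
    qed
    ultimately show "g0 h y + g2 y * (\<sigma>\<^sup>2 * h) + g4 y * (3 * \<sigma> ^ 4 * h\<^sup>2) \<le> y powr \<theta> - \<sigma>\<^sup>2 * \<theta>\<^sup>2 / 32 * h"
      using e1[unfolded e2] unfolding a_def[symmetric] p_def by linarith
  qed
qed

text \<open>Restriction to \<open>A\<close> keeps \<open>Y s\<close> in a compact interval away from
  0, so \<open>X\<close> is bounded although \<open>g\<close> may blow up at 0. Since
  \<open>X\<close> is measurable at time \<open>s\<close>, it is independent of the increment and
  the expectation factorizes.\<close>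

lemma increment_expectation:
  assumes s: "0 \<le> s" "0 < h" and A: "A \<in> sets (F s)"
    and Y: "\<And>\<omega>. \<omega> \<in> A \<Longrightarrow> Y s \<omega> \<in> {\<epsilon>..2}"
    and g: "g \<in> borel_measurable borel" "continuous_on {\<epsilon>..2} g"
  defines "X \<equiv> \<lambda>\<omega>. indicator A \<omega> * g (Y s \<omega>)" and "D \<equiv> \<lambda>\<omega>. W (s + h) \<omega> - W s \<omega>"
  shows "integrable M X" "integrable M (\<lambda>\<omega>. X \<omega> * D \<omega> ^ n)"
    and "expectation (\<lambda>\<omega>. X \<omega> * D \<omega> ^ n) = expectation X * expectation (\<lambda>\<omega>. D \<omega> ^ n)"
proof -
  have "bounded (g ` {\<epsilon>..2})"
    using g(2) by (intro compact_imp_bounded compact_continuous_image) auto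
  then obtain C where bnd: "\<bar>g (Y s \<omega>)\<bar> \<le> C" if "\<omega> \<in> A" for \<omega>
    unfolding bounded_iff using Y by (metis imageI real_norm_def)
  have XF: "X \<in> borel_measurable (F s)"
    unfolding X_def using A s by (intro borel_measurable_times measurable_compose[OF Y_F g(1)]) auto
  then have XM: "X \<in> borel_measurable M"
    using subalgebra[OF s(1)] measurable_from_subalg by blast
  show iX: "integrable M X"
  proof (rule integrable_const_bound)
    show "AE \<omega> in M. norm (X \<omega>) \<le> \<bar>C\<bar>"
      using bnd by (intro AE_I2) (force simp: X_def indicator_def)
  qed (rule XM)
  have nrm: "distributed M lborel D (normal_density 0 (\<sigma> * sqrt h))"
    using normal[of s "s + h"] s by (simp add: D_def)
  have iD: "integrable M (\<lambda>\<omega>. D \<omega> ^ n)"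
    using s \<sigma> by (intro normal_moments(1)[OF nrm]) auto
  have "indep_var borel X borel D"
    using indep[of s "s + h" X] s XF by (simp add: D_def)
  then have "indep_var borel ((\<lambda>x. x) \<circ> X) borel ((\<lambda>x. x ^ n) \<circ> D)"
    by (rule indep_var_compose) auto
  then have ind: "indep_var borel X borel (\<lambda>\<omega>. D \<omega> ^ n)" by (simp add: comp_def)
  show "integrable M (\<lambda>\<omega>. X \<omega> * D \<omega> ^ n)" by (rule indep_var_integrable[OF ind iX iD])
  show "expectation (\<lambda>\<omega>. X \<omega> * D \<omega> ^ n) = expectation X * expectation (\<lambda>\<omega>. D \<omega> ^ n)"
    by (rule indep_var_lebesgue_integral[OF ind iX iD])
qed

text \<open>\<open>euler_step\<close> gives a pointwise bound on \<open>B\<close> and a nonnegative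
  one on the rest of \<open>A\<close>. Independence replaces the powers 1, 2 and 4 of the increment
  by their moments, and the assumption on \<open>g0\<close>, \<open>g2\<close>, \<open>g4\<close>
  then yields the decrease on all of \<open>A\<close>.\<close>

lemma lyapunov_step:
  assumes \<epsilon>: "0 < \<epsilon>" and s: "0 \<le> s" "0 < h" and A: "A \<in> sets (F s)"
    and Y: "\<And>\<omega>. \<omega> \<in> A \<Longrightarrow> Y s \<omega> \<in> {\<epsilon>..2}"
    and mean: "\<And>y. \<epsilon> \<le> y \<Longrightarrow> y \<le> 2 \<Longrightarrow>
      g0 h y + g2 y * (\<sigma>\<^sup>2 * h) + g4 y * (3 * \<sigma> ^ 4 * h\<^sup>2) \<le> y powr \<theta> - \<sigma>\<^sup>2 * \<theta>\<^sup>2 / 32 * h"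
    and BA: "B \<subseteq> A"
    and B: "\<And>\<omega>. \<omega> \<in> B \<Longrightarrow> 0 \<le> Y (s + h) \<omega> \<and>
      Y (s + h) \<omega> \<le> Y s \<omega> + (W (s + h) \<omega> - W s \<omega>) + h * K / Y s \<omega>"
  shows "expectation (\<lambda>\<omega>. indicator B \<omega> * Y (s + h) \<omega> powr \<theta>)
    \<le> expectation (\<lambda>\<omega>. indicator A \<omega> * Y s \<omega> powr \<theta>) - \<sigma>\<^sup>2 * \<theta>\<^sup>2 / 32 * h * prob A"
proof -
  define D where "D = (\<lambda>\<omega>. W (s + h) \<omega> - W s \<omega>)"
  define X where "X = (\<lambda>g \<omega>. indicator A \<omega> * g (Y s \<omega>) :: real)"
  have nrm: "distributed M lborel D (normal_density 0 (\<sigma> * sqrt h))"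
    using normal[of s "s + h"] s by (simp add: D_def)
  have \<sigma>h: "0 < \<sigma> * sqrt h" using s \<sigma> by simp
  have mom: "expectation (\<lambda>\<omega>. D \<omega> ^ 1) = 0" "expectation (\<lambda>\<omega>. D \<omega> ^ 2) = \<sigma>\<^sup>2 * h"
      "expectation (\<lambda>\<omega>. D \<omega> ^ 4) = 3 * \<sigma> ^ 4 * h\<^sup>2"
  proof -
    have "sqrt h ^ 4 = (sqrt h ^ 2) ^ 2" by (simp flip: power_mult)
    then have "sqrt h ^ 4 = h\<^sup>2" using s by simp
    then show "expectation (\<lambda>\<omega>. D \<omega> ^ 1) = 0" "expectation (\<lambda>\<omega>. D \<omega> ^ 2) = \<sigma>\<^sup>2 * h"
      "expectation (\<lambda>\<omega>. D \<omega> ^ 4) = 3 * \<sigma> ^ 4 * h\<^sup>2"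
      using normal_moments(2-4)[OF nrm \<sigma>h] s by (simp_all add: power_mult_distrib)
  qed
  have cont: "continuous_on {\<epsilon>..2} (g0 h)" "continuous_on {\<epsilon>..2} (g1 h)" "continuous_on {\<epsilon>..2} g2"
      "continuous_on {\<epsilon>..2} g4" "continuous_on {\<epsilon>..2} (\<lambda>y. y powr \<theta>)"
    unfolding g0_def g1_def g2_def g4_def using \<epsilon> by (intro continuous_intros; auto)+
  have meas: "g0 h \<in> borel_measurable borel" "g1 h \<in> borel_measurable borel" "g2 \<in> borel_measurable borel"
      "g4 \<in> borel_measurable borel" "(\<lambda>y. y powr \<theta>) \<in> borel_measurable borel"
    unfolding g0_def[abs_def] g1_def[abs_def] g2_def[abs_def] g4_def[abs_def] by measurable
  have inc: "integrable M (X g)" "integrable M (\<lambda>\<omega>. X g \<omega> * D \<omega> ^ n)"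
      "expectation (\<lambda>\<omega>. X g \<omega> * D \<omega> ^ n) = expectation (X g) * expectation (\<lambda>\<omega>. D \<omega> ^ n)"
    if "g \<in> borel_measurable borel" "continuous_on {\<epsilon>..2} g" for g n
    using increment_expectation[OF s A Y that] unfolding X_def D_def by auto
  note I0 = inc(1)[OF meas(1) cont(1)] and I1 = inc(2,3)[OF meas(2) cont(2), of 1]
    and I2 = inc(1)[OF meas(3) cont(3)] inc(2,3)[OF meas(3) cont(3), of 2]
    and I4 = inc(1)[OF meas(4) cont(4)] inc(2,3)[OF meas(4) cont(4), of 4]
    and Ip = inc(1)[OF meas(5) cont(5)]
  have A_ev: "A \<in> events" using sets_F s A by blast
  define R where "R = (\<lambda>\<omega>. X (g0 h) \<omega> + X (g1 h) \<omega> * D \<omega> ^ 1 + X g2 \<omega> * D \<omega> ^ 2 + X g4 \<omega> * D \<omega> ^ 4)"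
  have R: "R \<omega> = indicator A \<omega> * (g0 h (Y s \<omega>) + g1 h (Y s \<omega>) * D \<omega> + g2 (Y s \<omega>) * (D \<omega>)\<^sup>2
      + g4 (Y s \<omega>) * D \<omega> ^ 4)" for \<omega>
    by (simp add: R_def X_def algebra_simps)
  have pos: "0 < Y s \<omega>" if "\<omega> \<in> A" for \<omega> using Y[OF that] \<epsilon> by auto
  \<comment> \<open>Here \<open>integral_mono'\<close> asks for integrability of the majorant only:
    a nonintegrable left side would have integral 0 by default, and \<open>0 \<le> R\<close> covers
    that case.\<close>
  have "expectation (\<lambda>\<omega>. indicator B \<omega> * Y (s + h) \<omega> powr \<theta>) \<le> expectation R"
  proof (rule integral_mono')
    show "integrable M R" unfolding R_def
      using I0 I1(1) I2(2) I4(2) by (intro Bochner_Integration.integrable_add) auto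
    show "0 \<le> R \<omega>" for \<omega>
      using euler_step(1)[OF pos] by (cases "\<omega> \<in> A") (auto simp: R)
    show "indicator B \<omega> * Y (s + h) \<omega> powr \<theta> \<le> R \<omega>" for \<omega>
    proof (cases "\<omega> \<in> B")
      case True
      then have "\<omega> \<in> A" using BA by auto
      then show ?thesis
        using euler_step(2)[OF pos, of \<omega> "Y (s + h) \<omega>" "D \<omega>" h] B[OF True] True by (auto simp: R D_def)
    qed (use \<open>0 \<le> R \<omega>\<close> in auto)
  qed
  also have "expectation R = expectation (X (g0 h)) + expectation (X g2) * (\<sigma>\<^sup>2 * h)
      + expectation (X g4) * (3 * \<sigma> ^ 4 * h\<^sup>2)"
    unfolding R_def using I0 I1 I2 I4 mom by (simp add: Bochner_Integration.integral_add)
  also have "\<dots> = expectation (\<lambda>\<omega>. X (g0 h) \<omega> + X g2 \<omega> * (\<sigma>\<^sup>2 * h) + X g4 \<omega> * (3 * \<sigma> ^ 4 * h\<^sup>2))"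
    using I0 I2 I4 by (simp add: Bochner_Integration.integral_add)
  also have "\<dots> \<le> expectation (\<lambda>\<omega>. X (\<lambda>y. y powr \<theta>) \<omega> - \<sigma>\<^sup>2 * \<theta>\<^sup>2 / 32 * h * indicator A \<omega>)"
  proof (rule integral_mono)
    show "integrable M (\<lambda>\<omega>. X (g0 h) \<omega> + X g2 \<omega> * (\<sigma>\<^sup>2 * h) + X g4 \<omega> * (3 * \<sigma> ^ 4 * h\<^sup>2))"
      using I0 I2(1) I4(1) by (intro Bochner_Integration.integrable_add integrable_mult_left) auto
    show "integrable M (\<lambda>\<omega>. X (\<lambda>y. y powr \<theta>) \<omega> - \<sigma>\<^sup>2 * \<theta>\<^sup>2 / 32 * h * indicator A \<omega>)"
      using Ip A_ev by (intro Bochner_Integration.integrable_diff integrable_mult_right)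
        (auto simp: integrable_indicator_iff emeasure_eq_measure)
    show "X (g0 h) \<omega> + X g2 \<omega> * (\<sigma>\<^sup>2 * h) + X g4 \<omega> * (3 * \<sigma> ^ 4 * h\<^sup>2)
        \<le> X (\<lambda>y. y powr \<theta>) \<omega> - \<sigma>\<^sup>2 * \<theta>\<^sup>2 / 32 * h * indicator A \<omega>" for \<omega>
      using mean[of "Y s \<omega>"] Y[of \<omega>] by (cases "\<omega> \<in> A") (auto simp: X_def)
  qed
  also have "\<dots> = expectation (X (\<lambda>y. y powr \<theta>)) - \<sigma>\<^sup>2 * \<theta>\<^sup>2 / 32 * h * prob A"
    using Ip A_ev by (subst Bochner_Integration.integral_diff)
      (auto simp: integrable_indicator_iff emeasure_eq_measure)
  finally show ?thesis by (simp add: X_def)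
qed

section \<open>Survival events on a time grid\<close>

text \<open>The event that the Euler inequality holds along \<open>k\<close> steps of length
  \<open>h\<close> while \<open>Y\<close> stays in \<open>[\<epsilon>, 2]\<close> at the grid times.
  It is decreasing in \<open>k\<close> and known at the last grid time. The grid starts at time 1
  because \<open>Y\<close> may vanish at time 0.\<close>

primrec euler_event :: "real \<Rightarrow> real \<Rightarrow> nat \<Rightarrow> 'w set" where
  "euler_event h \<epsilon> 0 = {\<omega> \<in> space M. Y 1 \<omega> \<in> {\<epsilon>..2}}"
| "euler_event h \<epsilon> (Suc k) = {\<omega> \<in> euler_event h \<epsilon> k. Y (1 + real k * h + h) \<omega> \<in> {\<epsilon>..2} \<and>
      Y (1 + real k * h + h) \<omega> \<le> Y (1 + real k * h) \<omega> +
        (W (1 + real k * h + h) \<omega> - W (1 + real k * h) \<omega>) + h * K / Y (1 + real k * h) \<omega>}"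

lemma F_measurable_mono:
  fixes f :: "'w \<Rightarrow> real"
  assumes "0 \<le> s" "s \<le> t" "f \<in> borel_measurable (F s)"
  shows "f \<in> borel_measurable (F t)"
  using assms F_mono[of s t] space_F[of s] space_F[of t]
  by (intro measurable_from_subalg[of "F t" "F s"]) (auto simp: subalgebra_def)

lemma euler_event_F:
  assumes h: "0 < h"
  shows "euler_event h \<epsilon> k \<in> sets (F (1 + real k * h))"
proof (induction k)
  case 0
  have [measurable]: "Y 1 \<in> borel_measurable (F 1)" by (rule Y_F) simp
  have "{\<omega> \<in> space (F 1). Y 1 \<omega> \<in> {\<epsilon>..2}} \<in> sets (F 1)" by measurable
  then show ?case by (simp add: space_F)
next
  case (Suc k)
  define s where "s = 1 + real k * h"
  have s: "0 \<le> s" using h by (simp add: s_def)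
  have [measurable]: "Y s \<in> borel_measurable (F (s + h))" "W s \<in> borel_measurable (F (s + h))"
      "Y (s + h) \<in> borel_measurable (F (s + h))" "W (s + h) \<in> borel_measurable (F (s + h))"
    using s h Y_F W_F by (auto intro: F_measurable_mono[of s "s + h"])
  have "{\<omega> \<in> space (F (s + h)). Y (s + h) \<omega> \<in> {\<epsilon>..2} \<and>
      Y (s + h) \<omega> \<le> Y s \<omega> + (W (s + h) \<omega> - W s \<omega>) + h * K / Y s \<omega>} \<in> sets (F (s + h))"
    by measurable
  moreover have "euler_event h \<epsilon> k \<in> sets (F (s + h))"
    using Suc F_mono[of s "s + h"] s h by (auto simp: s_def)
  ultimately have "euler_event h \<epsilon> k \<inter> {\<omega> \<in> space (F (s + h)). Y (s + h) \<omega> \<in> {\<epsilon>..2} \<and>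
      Y (s + h) \<omega> \<le> Y s \<omega> + (W (s + h) \<omega> - W s \<omega>) + h * K / Y s \<omega>} \<in> sets (F (s + h))"
    by (rule sets.Int[rotated])
  moreover have "euler_event h \<epsilon> k \<subseteq> space (F (s + h))"
    using calculation(1) \<open>euler_event h \<epsilon> k \<in> sets (F (s + h))\<close> by (rule_tac sets.sets_into_space)
  then have "euler_event h \<epsilon> (Suc k) = euler_event h \<epsilon> k \<inter> {\<omega> \<in> space (F (s + h)). Y (s + h) \<omega> \<in> {\<epsilon>..2} \<and>
      Y (s + h) \<omega> \<le> Y s \<omega> + (W (s + h) \<omega> - W s \<omega>) + h * K / Y s \<omega>}"
    by (auto simp: s_def)
  moreover have "1 + real (Suc k) * h = s + h" by (simp add: s_def algebra_simps)
  ultimately show ?case by simp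
qed

lemma euler_event_events: "0 < h \<Longrightarrow> euler_event h \<epsilon> k \<in> events"
  using euler_event_F sets_F[of "1 + real k * h"] by simp

lemma euler_event_range: "\<omega> \<in> euler_event h \<epsilon> k \<Longrightarrow> Y (1 + real k * h) \<omega> \<in> {\<epsilon>..2}"
  by (cases k) (auto simp: algebra_simps)

lemma euler_event_antimono: "\<delta> \<le> \<epsilon> \<Longrightarrow> euler_event h \<epsilon> k \<subseteq> euler_event h \<delta> k"
  by (induction k) auto

lemma euler_eventI:
  assumes "\<omega> \<in> space M" "\<And>t. 1 \<le> t \<Longrightarrow> t \<le> 1 + real k * h \<Longrightarrow> Y t \<omega> \<in> {\<epsilon>..2}" "0 < h"
    and "\<And>t. 1 \<le> t \<Longrightarrow> t + h \<le> 1 + real k * h \<Longrightarrow>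
      Y (t + h) \<omega> \<le> Y t \<omega> + (W (t + h) \<omega> - W t \<omega>) + h * K / Y t \<omega>"
  shows "\<omega> \<in> euler_event h \<epsilon> k"
  using assms
proof (induction k)
  case (Suc k)
  have "1 + real (Suc k) * h = 1 + real k * h + h" by (simp add: algebra_simps)
  moreover have "0 \<le> real k * h" using Suc.prems by simp
  ultimately show ?case using Suc.prems by (auto intro!: Suc.IH)
qed auto

text \<open>The mean \<open>v\<close> of the Lyapunov function on the survival event starts at no
  more than 2, stays nonnegative, and loses at least \<open>c * h\<close> times the probability of
  the event in each step. Summing over a total time \<open>T\<close> bounds the final probability by
  \<open>2 / (c * T)\<close>. Only the threshold \<open>N\<close> depends on \<epsilon>.\<close>

lemma prob_euler_event_le:
  assumes \<epsilon>: "0 < \<epsilon>" and T: "0 < T"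
  shows "\<exists>N. \<forall>n\<ge>N. prob (euler_event (T / real (Suc n)) \<epsilon> (Suc n)) \<le> 64 / (\<sigma>\<^sup>2 * \<theta>\<^sup>2 * T)"
proof -
  define c where "c = \<sigma>\<^sup>2 * \<theta>\<^sup>2 / 32"
  have c: "0 < c" using \<sigma> \<theta> by (simp add: c_def)
  obtain h\<^sub>0 where h0: "0 < h\<^sub>0" and mean: "\<And>h y. 0 < h \<Longrightarrow> h \<le> h\<^sub>0 \<Longrightarrow> \<epsilon> \<le> y \<Longrightarrow> y \<le> 2 \<Longrightarrow>
      g0 h y + g2 y * (\<sigma>\<^sup>2 * h) + g4 y * (3 * \<sigma> ^ 4 * h\<^sup>2) \<le> y powr \<theta> - c * h"
    using euler_step_mean[OF \<epsilon>] unfolding c_def by blast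
  obtain N where N: "T / h\<^sub>0 < real N" using reals_Archimedean2 by blast
  show ?thesis
  proof (intro exI[of _ N] allI impI)
    fix n assume n: "N \<le> n"
    define h where "h = T / real (Suc n)"
    define E where "E = euler_event h \<epsilon>"
    define v where "v = (\<lambda>k. expectation (\<lambda>\<omega>. indicator (E k) \<omega> * Y (1 + real k * h) \<omega> powr \<theta>))"
    have h: "0 < h" "h \<le> h\<^sub>0"
    proof -
      show "0 < h" using T by (simp add: h_def)
      have "T < h\<^sub>0 * real N" using N h0 by (simp add: field_simps)
      also have "\<dots> \<le> h\<^sub>0 * real (Suc n)" using n h0 by (intro mult_left_mono) auto
      finally show "h \<le> h\<^sub>0" by (simp add: h_def field_simps)
    qed
    have ev: "E k \<in> events" for k using h by (simp add: E_def euler_event_events)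
    have step: "v (Suc k) \<le> v k - c * h * prob (E k)" for k
    proof -
      define s where "s = 1 + real k * h"
      have "1 + real (Suc k) * h = s + h" by (simp add: s_def algebra_simps)
      moreover have "expectation (\<lambda>\<omega>. indicator (E (Suc k)) \<omega> * Y (s + h) \<omega> powr \<theta>)
          \<le> expectation (\<lambda>\<omega>. indicator (E k) \<omega> * Y s \<omega> powr \<theta>) - \<sigma>\<^sup>2 * \<theta>\<^sup>2 / 32 * h * prob (E k)"
      proof (rule lyapunov_step[OF \<epsilon> _ h(1)])
        show "0 \<le> s" using h by (simp add: s_def)
        show "E k \<in> sets (F s)" using euler_event_F[OF h(1)] by (simp add: E_def s_def)
        show "Y s \<omega> \<in> {\<epsilon>..2}" if "\<omega> \<in> E k" for \<omega>
          using euler_event_range that by (auto simp: E_def s_def)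
        show "g0 h y + g2 y * (\<sigma>\<^sup>2 * h) + g4 y * (3 * \<sigma> ^ 4 * h\<^sup>2) \<le> y powr \<theta> - \<sigma>\<^sup>2 * \<theta>\<^sup>2 / 32 * h"
          if "\<epsilon> \<le> y" "y \<le> 2" for y
          using mean[OF h that] by (simp add: c_def)
        show "E (Suc k) \<subseteq> E k" by (auto simp: E_def)
        show "0 \<le> Y (s + h) \<omega> \<and> Y (s + h) \<omega> \<le> Y s \<omega> + (W (s + h) \<omega> - W s \<omega>) + h * K / Y s \<omega>"
          if "\<omega> \<in> E (Suc k)" for \<omega>
          using that \<epsilon> by (auto simp: E_def s_def)
      qed
      ultimately show ?thesis by (simp only: v_def s_def c_def)
    qed
    have v0: "v 0 \<le> 2"
    proof -
      have "indicator (E 0) \<omega> * Y 1 \<omega> powr \<theta> \<le> 2" for \<omega>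
      proof (cases "\<omega> \<in> E 0")
        case True
        then have "0 < Y 1 \<omega>" "Y 1 \<omega> \<le> 2" using \<epsilon> by (auto simp: E_def)
        then have "Y 1 \<omega> powr \<theta> \<le> 2 powr \<theta>" using \<theta> by (intro powr_mono2) auto
        also have "\<dots> \<le> 2 powr 1" using \<theta> by (intro powr_mono) auto
        finally show ?thesis using True by simp
      qed auto
      then have "v 0 \<le> expectation (\<lambda>_. 2)"
        unfolding v_def by (intro integral_mono') auto
      then show ?thesis by (simp add: prob_space)
    qed
    \<comment> \<open>The events decrease in \<open>k\<close>, so all earlier losses may be counted
      with the current, smallest probability.\<close>
    have sum: "v k \<le> 2 - c * h * real k * prob (E k)" for k
    proof (induction k)
      case (Suc k)
      have "prob (E (Suc k)) \<le> prob (E k)"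
        using ev by (intro finite_measure_mono) (auto simp: E_def)
      then have "c * h * real (Suc k) * prob (E (Suc k)) \<le> c * h * real (Suc k) * prob (E k)"
        using c h by (intro mult_left_mono) auto
      also have "\<dots> = c * h * real k * prob (E k) + c * h * prob (E k)"
        by (simp add: algebra_simps)
      finally show ?case using Suc step[of k] by linarith
    qed (use v0 in simp)
    have "0 \<le> v (Suc n)" unfolding v_def by (intro integral_nonneg_AE AE_I2) auto
    then have "c * (h * real (Suc n)) * prob (E (Suc n)) \<le> 2" using sum[of "Suc n"] by (simp add: mult_ac)
    moreover have "h * real (Suc n) = T" by (simp add: h_def)
    ultimately have "c * T * prob (E (Suc n)) \<le> 2" by (simp only:)
    then have "prob (E (Suc n)) \<le> 2 / (c * T)"
      using c T by (simp add: field_simps)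
    also have "\<dots> = 64 / (\<sigma>\<^sup>2 * \<theta>\<^sup>2 * T)" by (simp add: c_def)
    finally show "prob (euler_event (T / real (Suc n)) \<epsilon> (Suc n)) \<le> 64 / (\<sigma>\<^sup>2 * \<theta>\<^sup>2 * T)"
      by (simp add: E_def h_def)
  qed
qed

section \<open>From positive paths to grid events, and the limit\<close>

text \<open>On the compact interval \<open>[1, 1 + T]\<close> a positive continuous path has a
  positive minimum, which gives \<open>i\<close>, and \<open>K' / Y\<close> is uniformly continuous,
  which gives \<open>k\<close>. The gap between \<open>K'\<close> and \<open>K\<close> pays for
  freezing the drift at the left end of each step.\<close>

lemma path_in_euler_event:
  assumes \<omega>: "\<omega> \<in> space M" and K': "0 \<le> K'" "K' < K"
    and cont: "continuous_on {0..} (\<lambda>t. Y t \<omega>)"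
    and range: "\<And>t. 0 \<le> t \<Longrightarrow> Y t \<omega> \<in> {0..2}"
    and incr: "\<And>s t c. 0 < s \<Longrightarrow> s < t \<Longrightarrow> (\<And>r. r \<in> {s..t} \<Longrightarrow> 0 < Y r \<omega> \<and> K' / Y r \<omega> \<le> c) \<Longrightarrow>
      Y t \<omega> - Y s \<omega> \<le> W t \<omega> - W s \<omega> + c * (t - s)"
    and nz: "\<And>t. 0 < t \<Longrightarrow> Y t \<omega> \<noteq> 0" and T: "0 < T"
  shows "\<exists>i k. \<forall>n\<ge>k. \<omega> \<in> euler_event (T / real (Suc n)) (1 / real (Suc i)) (Suc n)"
proof -
  define S where "S = {1..1 + T}"
  have S: "compact S" "S \<noteq> {}" using T by (auto simp: S_def)
  have pos: "0 < Y t \<omega>" if "0 < t" for t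
    using range[of t] nz[of t] that by auto
  have contS: "continuous_on S (\<lambda>t. Y t \<omega>)"
    by (rule continuous_on_subset[OF cont]) (auto simp: S_def)
  obtain t\<^sub>0 where t0: "t\<^sub>0 \<in> S" "\<And>t. t \<in> S \<Longrightarrow> Y t\<^sub>0 \<omega> \<le> Y t \<omega>"
    using continuous_attains_inf[OF S contS] by blast
  have "0 < Y t\<^sub>0 \<omega>" using t0(1) by (intro pos) (auto simp: S_def)
  then obtain i where i: "1 / real (Suc i) < Y t\<^sub>0 \<omega>"
    using reals_Archimedean[of "Y t\<^sub>0 \<omega>"] by (auto simp: inverse_eq_divide)
  have "Y t \<omega> \<noteq> 0" if "t \<in> S" for t
    using pos[of t] that by (auto simp: S_def)
  then have "continuous_on S (\<lambda>t. K' / Y t \<omega>)"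
    using contS by (intro continuous_on_divide continuous_on_const) auto
  then have "uniformly_continuous_on S (\<lambda>t. K' / Y t \<omega>)"
    using S by (intro compact_uniformly_continuous)
  \<comment> \<open>This tolerance works for every level of the path: \<open>Y \<le> 2\<close> gives
    \<open>(K - K') / 2 \<le> (K - K') / Y t \<omega>\<close>, so \<open>K' / Y\<close> stays below
    \<open>K / Y t \<omega>\<close> during the step.\<close>
  moreover have "0 < (K - K') / 2" using K' by simp
  ultimately obtain d where d: "0 < d" "\<And>s t. s \<in> S \<Longrightarrow> t \<in> S \<Longrightarrow> dist t s < d \<Longrightarrow>
      dist (K' / Y t \<omega>) (K' / Y s \<omega>) < (K - K') / 2"
    unfolding uniformly_continuous_on_def by blast
  obtain k where k: "T / d < real k" using reals_Archimedean2 by blast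
  show ?thesis
  proof (intro exI allI impI)
    fix n assume n: "k \<le> n"
    define h where "h = T / real (Suc n)"
    have hT: "real (Suc n) * h = T" by (simp add: h_def)
    have h: "0 < h" "h < d"
    proof -
      show "0 < h" using T by (simp add: h_def)
      have "T < d * real k" using k d by (simp add: field_simps)
      also have "\<dots> \<le> d * real (Suc n)" using n d by (intro mult_left_mono) auto
      finally show "h < d" by (simp add: h_def field_simps)
    qed
    show "\<omega> \<in> euler_event (T / real (Suc n)) (1 / real (Suc i)) (Suc n)"
      unfolding h_def[symmetric]
    proof (rule euler_eventI[OF \<omega> _ h(1)])
      show "Y t \<omega> \<in> {1 / real (Suc i)..2}" if "1 \<le> t" "t \<le> 1 + real (Suc n) * h" for t
        using that t0(2)[of t] i range[of t] unfolding hT by (auto simp: S_def)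
      show "Y (t + h) \<omega> \<le> Y t \<omega> + (W (t + h) \<omega> - W t \<omega>) + h * K / Y t \<omega>"
        if t: "1 \<le> t" "t + h \<le> 1 + real (Suc n) * h" for t
      proof -
        have "0 < Y r \<omega> \<and> K' / Y r \<omega> \<le> K / Y t \<omega>" if r: "r \<in> {t..t + h}" for r
        proof
          show "0 < Y r \<omega>" using r t by (intro pos) auto
          have tS: "t \<in> S" "r \<in> S" using t r h unfolding hT by (auto simp: S_def)
          have "dist r t < d" using r h by (auto simp: dist_real_def)
          then have "\<bar>K' / Y r \<omega> - K' / Y t \<omega>\<bar> < (K - K') / 2"
            using d(2)[OF tS] by (simp add: dist_real_def)
          moreover have "(K - K') / 2 \<le> (K - K') / Y t \<omega>"
            using range[of t] pos[of t] t K' by (intro frac_le) auto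
          ultimately show "K' / Y r \<omega> \<le> K / Y t \<omega>" by (simp add: diff_divide_distrib abs_less_iff)
        qed
        then have "Y (t + h) \<omega> - Y t \<omega> \<le> W (t + h) \<omega> - W t \<omega> + K / Y t \<omega> * (t + h - t)"
          using t h by (intro incr) auto
        then show ?thesis by (simp add: algebra_simps)
      qed
    qed
  qed
qed

text \<open>A path without positive zeros lies in \<open>U T\<close> for every \<open>T > 0\<close>,
  and \<open>prob (U T)\<close> is of order \<open>1 / T\<close>. Hence such paths lie in the null
  set \<open>Z\<close>.\<close>

theorem hits_zero:
  assumes K': "0 \<le> K'" "K' < K"
    and cont: "AE \<omega> in M. continuous_on {0..} (\<lambda>t. Y t \<omega>)"
    and range: "AE \<omega> in M. \<forall>t\<ge>0. Y t \<omega> \<in> {0..2}"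
    and incr: "AE \<omega> in M. \<forall>s t c. 0 < s \<longrightarrow> s < t \<longrightarrow> (\<forall>r\<in>{s..t}. 0 < Y r \<omega> \<and> K' / Y r \<omega> \<le> c) \<longrightarrow>
      Y t \<omega> - Y s \<omega> \<le> W t \<omega> - W s \<omega> + c * (t - s)"
  shows "AE \<omega> in M. \<exists>t>0. Y t \<omega> = 0"
proof -
  \<comment> \<open>The index \<open>i\<close> gives the lower level \<open>1 / (i + 1)\<close>, and
    \<open>k\<close> is the number from which all finer grids succeed.\<close>
  define U where "U = (\<lambda>T. \<Union>i. \<Union>k. \<Inter>n\<in>{k..}. euler_event (T / real (Suc n)) (1 / real (Suc i)) (Suc n))"
  define a where "a = 64 / (\<sigma>\<^sup>2 * \<theta>\<^sup>2)"
  have ev: "(\<Union>k. \<Inter>n\<in>{k..}. euler_event (T / real (Suc n)) \<epsilon> (Suc n)) \<in> events" if "0 < T" for T \<epsilon>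
    using that by (intro sets.countable_UN'' sets.countable_INT' countableI_type euler_event_events)
      (auto intro: euler_event_events simp del: euler_event.simps)
  have U_ev: "U T \<in> events" if "0 < T" for T
    unfolding U_def by (rule sets.countable_UN, rule image_subsetI, rule ev[OF that])
  have U_le: "prob (U T) \<le> a / T" if T: "0 < T" for T
    unfolding U_def
  proof (rule union_incseq_prob_le)
    \<comment> \<open>Lowering the level enlarges the events, and the bound on each of them does not
      involve the level, so it passes to the union over \<open>i\<close>.\<close>
    show "incseq (\<lambda>i. \<Union>k. \<Inter>n\<in>{k..}. euler_event (T / real (Suc n)) (1 / real (Suc i)) (Suc n))"
    proof (rule incseq_SucI)
      fix i
      show "(\<Union>k. \<Inter>n\<in>{k..}. euler_event (T / real (Suc n)) (1 / real (Suc i)) (Suc n))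
          \<subseteq> (\<Union>k. \<Inter>n\<in>{k..}. euler_event (T / real (Suc n)) (1 / real (Suc (Suc i))) (Suc n))"
        by (intro UN_mono INT_anti_mono euler_event_antimono subset_refl) (auto simp: field_simps)
    qed
    fix i
    obtain N where "\<And>n. N \<le> n \<Longrightarrow> prob (euler_event (T / real (Suc n)) (1 / real (Suc i)) (Suc n)) \<le> a / T"
      using prob_euler_event_le[OF _ T, of "1 / real (Suc i)"] by (auto simp: a_def)
    then show "prob (\<Union>k. \<Inter>n\<in>{k..}. euler_event (T / real (Suc n)) (1 / real (Suc i)) (Suc n)) \<le> a / T"
      using T by (intro liminf_prob_le euler_event_events)
        (auto intro: euler_event_events simp del: euler_event.simps)
  qed (rule image_subsetI, rule ev[OF T])
  define Z where "Z = (\<Inter>j. U (real (Suc j)))"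
  have Z_ev: "Z \<in> events" unfolding Z_def by (rule sets.countable_INT) (use U_ev in auto)
  have "prob Z \<le> a / real (Suc j)" for j
  proof -
    have "prob Z \<le> prob (U (real (Suc j)))" by (intro finite_measure_mono U_ev) (auto simp: Z_def)
    also have "\<dots> \<le> a / real (Suc j)" by (intro U_le) auto
    finally show ?thesis .
  qed
  moreover have "(\<lambda>j. a / real (Suc j)) \<longlonglongrightarrow> 0"
    by (rule LIMSEQ_Suc[OF lim_const_over_n])
  ultimately have "prob Z \<le> 0" by (intro LIMSEQ_le_const) auto
  then have "prob Z = 0" by (simp add: measure_le_0_iff)
  then have "Z \<in> null_sets M" using Z_ev by (intro null_setsI) (simp_all add: emeasure_eq_measure)
  from AE_not_in[OF this] cont range incr AE_space show ?thesis
  proof eventually_elim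
    case (elim \<omega>)
    show ?case
    proof (rule ccontr)
      assume "\<not> (\<exists>t>0. Y t \<omega> = 0)"
      then have path: "\<exists>i k. \<forall>n\<ge>k. \<omega> \<in> euler_event (real (Suc j) / real (Suc n)) (1 / real (Suc i)) (Suc n)" for j
        using elim by (intro path_in_euler_event[OF _ K']) auto
      have "\<omega> \<in> U (real (Suc j))" for j
      proof -
        obtain i k where ik: "\<And>n. k \<le> n \<Longrightarrow> \<omega> \<in> euler_event (real (Suc j) / real (Suc n)) (1 / real (Suc i)) (Suc n)"
          using path[of j] by blast
        then show ?thesis
          unfolding U_def
          by (rule_tac UN_I[of i], simp, rule_tac UN_I[of k], simp, rule_tac INT_I, rule_tac ik, simp)
      qed
      then have "\<omega> \<in> Z" unfolding Z_def by blast
      with elim show False by simp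
    qed
  qed
qed

end

section \<open>Brownian increments and the augmented filtration\<close>

lemma std_brownian_motionD:
  assumes "std_brownian_motion M m \<nu>"
  shows "prob_space M"
    and "\<And>t i. 0 \<le> t \<Longrightarrow> i \<in> {1..m} \<Longrightarrow> (\<lambda>\<omega>. \<nu> t \<omega> i) \<in> borel_measurable M"
    and "\<And>n \<tau>. 0 \<le> \<tau> 0 \<Longrightarrow> (\<And>k. k < n \<Longrightarrow> \<tau> k \<le> \<tau> (Suc k)) \<Longrightarrow>
      prob_space.indep_vars M (\<lambda>_. borel)
        (\<lambda>(i, k) \<omega>. \<nu> (\<tau> (Suc k)) \<omega> i - \<nu> (\<tau> k) \<omega> i) ({1..m} \<times> {..<n})"
    and "\<And>i s t. i \<in> {1..m} \<Longrightarrow> 0 \<le> s \<Longrightarrow> s < t \<Longrightarrow>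
      distributed M lborel (\<lambda>\<omega>. \<nu> t \<omega> i - \<nu> s \<omega> i) (normal_density 0 (sqrt (t - s)))"
    and "AE \<omega> in M. \<forall>i\<in>{1..m}. \<nu> 0 \<omega> i = 0"
  using assms unfolding std_brownian_motion_def by auto

text \<open>Coordinate increments over one interval are independent normals, and so is any family of
  their nonzero multiples; variances add up. Nonzero coefficients keep every standard deviation
  positive, as the sum rule for normals requires.\<close>

lemma bm_linear_increment_normal:
  assumes bm: "std_brownian_motion M m \<nu>" and I: "I \<subseteq> {1..m}" "I \<noteq> {}" "\<And>i. i \<in> I \<Longrightarrow> a i \<noteq> 0"
    and st: "0 \<le> s" "s < t"
  shows "distributed M lborel (\<lambda>\<omega>. (\<Sum>i\<in>I. a i * \<nu> t \<omega> i) - (\<Sum>i\<in>I. a i * \<nu> s \<omega> i))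
    (normal_density 0 (sqrt (\<Sum>i\<in>I. (a i)\<^sup>2) * sqrt (t - s)))"
proof -
  note bmD = std_brownian_motionD[OF bm]
  interpret prob_space M by (rule bmD)
  have fin: "finite I" using I(1) finite_subset by blast
  define X where "X = (\<lambda>i \<omega>. a i * (\<nu> t \<omega> i - \<nu> s \<omega> i))"
  define \<tau> where "\<tau> = (\<lambda>k::nat. if k = 0 then s else t)"
  have "indep_vars (\<lambda>_. borel) (\<lambda>(i, k) \<omega>. \<nu> (\<tau> (Suc k)) \<omega> i - \<nu> (\<tau> k) \<omega> i) ({1..m} \<times> {..<1::nat})"
    by (rule bmD(3)) (use st in \<open>auto simp: \<tau>_def\<close>)
  \<comment> \<open>The joint independence is indexed by pairs of coordinate and interval. Grouping
    into the singletons \<open>{(i, 0)}\<close> and evaluating reindexes it by the coordinate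
    alone.\<close>
  then have "indep_vars (\<lambda>i. PiM {(i, 0)} (\<lambda>_. borel)) (\<lambda>i \<omega>. \<lambda>j\<in>{(i, 0)}.
      (\<lambda>(i, k) \<omega>. \<nu> (\<tau> (Suc k)) \<omega> i - \<nu> (\<tau> k) \<omega> i) j \<omega>) I"
    by (rule indep_vars_restrict) (use I(1) in \<open>auto simp: disjoint_family_on_def\<close>)
  then have "indep_vars (\<lambda>_. borel) (\<lambda>i \<omega>. (\<lambda>j\<in>{(i, 0)}.
      (\<lambda>(i, k) \<omega>. \<nu> (\<tau> (Suc k)) \<omega> i - \<nu> (\<tau> k) \<omega> i) j \<omega>) (i, 0)) I"
    by (rule indep_vars_compose2) (auto intro: measurable_component_singleton)
  then have "indep_vars (\<lambda>_. borel) (\<lambda>i \<omega>. \<nu> t \<omega> i - \<nu> s \<omega> i) I"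
    by (simp add: \<tau>_def)
  then have ind: "indep_vars (\<lambda>_. borel) X I"
    unfolding X_def by (rule indep_vars_compose2) simp
  have nrm: "distributed M lborel (X i) (normal_density 0 (\<bar>a i\<bar> * sqrt (t - s)))" if "i \<in> I" for i
    using normal_density_affine[OF bmD(4)[of i s t], of "a i" 0] that I st unfolding X_def by auto
  have "distributed M lborel (\<lambda>x. \<Sum>i\<in>I. X i x)
      (normal_density (\<Sum>i\<in>I. 0) (sqrt (\<Sum>i\<in>I. (\<bar>a i\<bar> * sqrt (t - s))\<^sup>2)))"
    using fin I st by (intro sum_indep_normal ind nrm) auto
  moreover have "(\<Sum>i\<in>I. (\<bar>a i\<bar> * sqrt (t - s))\<^sup>2) = (\<Sum>i\<in>I. (a i)\<^sup>2) * (t - s)"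
    using st by (simp add: power_mult_distrib sum_distrib_right)
  moreover have "(\<lambda>x. \<Sum>i\<in>I. X i x) = (\<lambda>\<omega>. (\<Sum>i\<in>I. a i * \<nu> t \<omega> i) - (\<Sum>i\<in>I. a i * \<nu> s \<omega> i))"
    by (simp add: X_def right_diff_distrib sum_subtractf)
  ultimately show ?thesis by (simp add: real_sqrt_mult)
qed

text \<open>Along the sorted times of \<open>J\<close>, every \<open>\<nu> r - \<nu> 0\<close> is a
  telescoping sum of increments before \<open>s\<close>, whereas \<open>Z\<close> uses only
  increments over \<open>[s, t]\<close>. These are two disjoint blocks of one jointly independent
  family.\<close>

lemma bm_cylinder_indep:
  fixes a :: "nat \<Rightarrow> real"
  assumes bm: "std_brownian_motion M m \<nu>" and I: "I \<subseteq> {1..m}" and st: "0 \<le> s" "s < t"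
    and J: "finite J" "J \<subseteq> {1..m} \<times> {0..s}" "\<And>j. j \<in> J \<Longrightarrow> B j \<in> sets borel" and D: "D \<in> sets borel"
  defines "Z \<equiv> \<lambda>\<omega>. (\<Sum>i\<in>I. a i * \<nu> t \<omega> i) - (\<Sum>i\<in>I. a i * \<nu> s \<omega> i)"
    and "E \<equiv> {\<omega> \<in> space M. \<forall>(i, r)\<in>J. \<nu> r \<omega> i - \<nu> 0 \<omega> i \<in> B (i, r)}"
  shows "measure M (E \<inter> (Z -` D \<inter> space M)) = measure M E * measure M (Z -` D \<inter> space M)"
proof -
  note bmD = std_brownian_motionD[OF bm]
  interpret prob_space M by (rule bmD)
  \<comment> \<open>Including 0 and \<open>s\<close> makes the grid start at 0 and end at
    \<open>s\<close>, whatever times occur in \<open>J\<close>.\<close>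
  define T where "T = insert 0 (insert s (snd ` J))"
  define n where "n = card T - 1"
  define xs where "xs = sorted_list_of_set T"
  have T: "finite T" "T \<subseteq> {0..s}" "0 \<in> T" "s \<in> T"
    using J st by (auto simp: T_def)
  have xs: "sorted xs" "set xs = T" "length xs = Suc n"
    using T card_gt_0_iff[of T] by (auto simp: xs_def n_def)
  \<comment> \<open>The grid reaches \<open>s\<close> at index \<open>n\<close> and is
    \<open>t\<close> afterwards, so increment number \<open>n\<close> is the one over
    \<open>[s, t]\<close>: block \<open>P\<close> is the past, block \<open>Q\<close> the
    future.\<close>
  define \<tau> where "\<tau> = (\<lambda>k. if k \<le> n then xs ! k else t)"
  have \<tau>T: "\<tau> k \<in> T" if "k \<le> n" for k using xs that by (auto simp: \<tau>_def)
  have mono: "\<tau> k \<le> \<tau> l" if "k \<le> l" "l \<le> n" for k l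
    using xs that by (simp add: \<tau>_def sorted_nth_mono)
  have idx: "\<exists>k\<le>n. \<tau> k = r" if "r \<in> T" for r
  proof -
    have "r \<in> set xs" using that xs by simp
    then obtain k where "k < length xs" "xs ! k = r" by (auto simp: in_set_conv_nth)
    then show ?thesis using xs by (intro exI[of _ k]) (auto simp: \<tau>_def)
  qed
  have \<tau>0: "\<tau> 0 = 0"
  proof -
    obtain k where "k \<le> n" "\<tau> k = 0" using idx[OF T(3)] by auto
    moreover have "0 \<le> \<tau> 0" using \<tau>T[of 0] T(2) by auto
    ultimately show ?thesis using mono[of 0 k] by linarith
  qed
  have \<tau>n: "\<tau> n = s"
  proof -
    obtain k where "k \<le> n" "\<tau> k = s" using idx[OF T(4)] by auto
    moreover have "\<tau> n \<le> s" using \<tau>T[of n] T(2) by auto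
    ultimately show ?thesis using mono[of k n] by linarith
  qed
  define kk where "kk = (\<lambda>r. SOME k. k \<le> n \<and> \<tau> k = r)"
  have kk: "kk r \<le> n" "\<tau> (kk r) = r" if "r \<in> T" for r
    using someI_ex[of "\<lambda>k. k \<le> n \<and> \<tau> k = r"] idx[OF that] unfolding kk_def by auto
  define X where "X = (\<lambda>(i, k) \<omega>. \<nu> (\<tau> (Suc k)) \<omega> i - \<nu> (\<tau> k) \<omega> i)"
  define P where "P = {1..m} \<times> {..<n}"
  define Q where "Q = {1..m} \<times> {n}"
  have "indep_vars (\<lambda>_. borel) X ({1..m} \<times> {..<Suc n})"
    unfolding X_def
  proof (rule bmD(3))
    show "0 \<le> \<tau> 0" by (simp add: \<tau>0)
    show "\<tau> k \<le> \<tau> (Suc k)" if "k < Suc n" for k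
    proof (cases "k = n")
      case True
      then show ?thesis using st \<tau>n by (simp add: \<tau>_def)
    qed (use that mono in auto)
  qed
  then have ind: "indep_var (PiM P (\<lambda>_. borel)) (\<lambda>\<omega>. \<lambda>j\<in>P. X j \<omega>) (PiM Q (\<lambda>_. borel)) (\<lambda>\<omega>. \<lambda>j\<in>Q. X j \<omega>)"
    by (rule indep_var_restrict) (auto simp: P_def Q_def)
  define E' where "E' = {f \<in> space (PiM P (\<lambda>_. borel::real measure)). \<forall>(i, r)\<in>J. (\<Sum>l<kk r. f (i, l)) \<in> B (i, r)}"
  define D' where "D' = {f \<in> space (PiM Q (\<lambda>_. borel::real measure)). (\<Sum>i\<in>I. a i * f (i, n)) \<in> D}"
  have JT: "i \<in> {1..m}" "r \<in> T" if "(i, r) \<in> J" for i r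
    using that J by (auto simp: T_def image_iff intro: bexI[of _ "(i, r)"])
  have E': "E' \<in> sets (PiM P (\<lambda>_. borel))"
    unfolding E'_def case_prod_beta
  proof (intro sets.sets_Collect_finite_All J(1))
    fix j assume j: "j \<in> J"
    obtain i r where ir: "j = (i, r)" by force
    have "(\<lambda>f. f (i, l)) \<in> borel_measurable (PiM P (\<lambda>_. borel::real measure))" if "l < kk r" for l
      using that j JT[of i r] kk[of r] by (intro measurable_component_singleton) (auto simp: P_def ir)
    then have "(\<lambda>f. \<Sum>l<kk r. f (i, l)) \<in> borel_measurable (PiM P (\<lambda>_. borel::real measure))"
      by (intro borel_measurable_sum) auto
    from measurable_sets[OF this J(3)[OF j]]
    show "{f \<in> space (PiM P (\<lambda>_. borel)). (\<Sum>l<kk (snd j). f (fst j, l)) \<in> B (fst j, snd j)}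
        \<in> sets (PiM P (\<lambda>_. borel::real measure))"
      by (simp add: ir vimage_def Int_def conj_commute)
  qed
  have D': "D' \<in> sets (PiM Q (\<lambda>_. borel))"
  proof -
    have "(\<lambda>f. f (i, n)) \<in> borel_measurable (PiM Q (\<lambda>_. borel::real measure))" if "i \<in> I" for i
      using that I by (intro measurable_component_singleton) (auto simp: Q_def)
    then have "(\<lambda>f. \<Sum>i\<in>I. a i * f (i, n)) \<in> borel_measurable (PiM Q (\<lambda>_. borel::real measure))"
      by (intro borel_measurable_sum borel_measurable_times) auto
    from measurable_sets[OF this D] show ?thesis
      by (simp add: D'_def vimage_def Int_def conj_commute)
  qed
  have tele: "(\<Sum>l<kk r. X (i, l) \<omega>) = \<nu> r \<omega> i - \<nu> 0 \<omega> i" if "r \<in> T" for i r \<omega>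
    using kk[OF that] sum_lessThan_telescope[of "\<lambda>l. \<nu> (\<tau> l) \<omega> i" "kk r"] by (simp add: X_def \<tau>0)
  have eqE: "(\<lambda>\<omega>. \<lambda>j\<in>P. X j \<omega>) -` E' \<inter> space M = E"
  proof -
    have "(\<Sum>l<kk r. (\<lambda>j\<in>P. X j \<omega>) (i, l)) = \<nu> r \<omega> i - \<nu> 0 \<omega> i" if "(i, r) \<in> J" for i r \<omega>
    proof -
      have "(\<Sum>l<kk r. (\<lambda>j\<in>P. X j \<omega>) (i, l)) = (\<Sum>l<kk r. X (i, l) \<omega>)"
        using JT[OF that] kk[OF JT(2)[OF that]] by (intro sum.cong) (auto simp: P_def)
      then show ?thesis using tele JT(2)[OF that] by simp
    qed
    then show ?thesis by (fastforce simp: E'_def E_def space_PiM)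
  qed
  have eqD: "(\<lambda>\<omega>. \<lambda>j\<in>Q. X j \<omega>) -` D' \<inter> space M = Z -` D \<inter> space M"
  proof -
    have "(\<Sum>i\<in>I. a i * (\<lambda>j\<in>Q. X j \<omega>) (i, n)) = Z \<omega>" for \<omega>
    proof -
      have "(\<Sum>i\<in>I. a i * (\<lambda>j\<in>Q. X j \<omega>) (i, n)) = (\<Sum>i\<in>I. a i * X (i, n) \<omega>)"
        using I by (intro sum.cong) (auto simp: Q_def)
      also have "\<dots> = Z \<omega>"
        using \<tau>n by (simp add: Z_def X_def \<tau>_def right_diff_distrib sum_subtractf)
      finally show ?thesis .
    qed
    then show ?thesis by (auto simp: D'_def space_PiM)
  qed
  have "prob ((\<lambda>\<omega>. (\<lambda>j\<in>P. X j \<omega>, \<lambda>j\<in>Q. X j \<omega>)) -` (E' \<times> D') \<inter> space M) = prob E * prob (Z -` D \<inter> space M)"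
    using indep_varD[OF ind E' D'] eqE eqD by simp
  moreover have "(\<lambda>\<omega>. (\<lambda>j\<in>P. X j \<omega>, \<lambda>j\<in>Q. X j \<omega>)) -` (E' \<times> D') \<inter> space M = E \<inter> (Z -` D \<inter> space M)"
    using eqE eqD by auto
  ultimately show ?thesis by simp
qed

section \<open>Independence of the future from the augmented filtration\<close>

definition filtration_generator ::
    "'w measure \<Rightarrow> nat \<Rightarrow> (real \<Rightarrow> 'w \<Rightarrow> nat \<Rightarrow> real) \<Rightarrow> real \<Rightarrow> 'w set set" where
  "filtration_generator M m \<nu> t =
     {(\<lambda>\<omega>. \<nu> s \<omega> i) -` B \<inter> space M | s i B. 0 \<le> s \<and> s \<le> t \<and> i \<in> {1..m} \<and> B \<in> sets borel}
     \<union> null_sets M"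

lemma filtration_generator_subset:
  "std_brownian_motion M m \<nu> \<Longrightarrow> filtration_generator M m \<nu> t \<subseteq> sets M"
  using std_brownian_motionD(2)[of M m \<nu>]
  by (auto simp: filtration_generator_def intro: measurable_sets)

lemma
  assumes "std_brownian_motion M m \<nu>"
  shows space_augmented_filtration: "space (augmented_filtration M m \<nu> t) = space M"
    and sets_augmented_filtration:
      "sets (augmented_filtration M m \<nu> t) = sigma_sets (space M) (filtration_generator M m \<nu> t)"
proof -
  have "filtration_generator M m \<nu> t \<subseteq> Pow (space M)"
    using filtration_generator_subset[OF assms] sets.sets_into_space by blast
  then show "space (augmented_filtration M m \<nu> t) = space M"
    "sets (augmented_filtration M m \<nu> t) = sigma_sets (space M) (filtration_generator M m \<nu> t)"
    unfolding augmented_filtration_def filtration_generator_def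
    by (auto simp: space_measure_of_conv sets_measure_of)
qed

lemma augmented_filtration:
  assumes bm: "std_brownian_motion M m \<nu>" and t: "0 \<le> t"
  shows "subalgebra M (augmented_filtration M m \<nu> t)"
    and "s \<le> t \<Longrightarrow> sets (augmented_filtration M m \<nu> s) \<subseteq> sets (augmented_filtration M m \<nu> t)"
    and "i \<in> {1..m} \<Longrightarrow> (\<lambda>\<omega>. \<nu> t \<omega> i) \<in> borel_measurable (augmented_filtration M m \<nu> t)"
proof -
  note sp = space_augmented_filtration[OF bm] and se = sets_augmented_filtration[OF bm]
  show "subalgebra M (augmented_filtration M m \<nu> t)"
    using sets.sigma_sets_subset[OF filtration_generator_subset[OF bm]] by (simp add: subalgebra_def sp se)
  show "sets (augmented_filtration M m \<nu> s) \<subseteq> sets (augmented_filtration M m \<nu> t)" if "s \<le> t"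
    unfolding se using that 
    by (intro sigma_sets_mono') (auto simp: filtration_generator_def intro: order_trans)
  show "(\<lambda>\<omega>. \<nu> t \<omega> i) \<in> borel_measurable (augmented_filtration M m \<nu> t)" if "i \<in> {1..m}"
  proof (rule measurableI)
    fix B :: "real set" assume "B \<in> sets borel"
    then have "(\<lambda>\<omega>. \<nu> t \<omega> i) -` B \<inter> space M \<in> filtration_generator M m \<nu> t" using t that by (auto simp: filtration_generator_def)
    then show "(\<lambda>\<omega>. \<nu> t \<omega> i) -` B \<inter> space (augmented_filtration M m \<nu> t) \<in> sets (augmented_filtration M m \<nu> t)"
      unfolding sp se by (rule sigma_sets.Basic)
  qed auto
qed

text \<open>A pi-system argument: \<open>G\<close> consists of the events that agree almost surely
  with a finite cylinder of increments from time 0. It is stable under intersection, independent of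
  \<open>Z\<close> by \<open>bm_cylinder_indep\<close>, and contains the generators of the
  filtration, so independence extends to the generated sigma-algebra.\<close>

lemma bm_augmented_indep:
  fixes a :: "nat \<Rightarrow> real" and X :: "'w \<Rightarrow> real"
  assumes bm: "std_brownian_motion M m \<nu>" and m: "1 \<le> m" and I: "I \<subseteq> {1..m}" and st: "0 \<le> s" "s < t"
    and X: "X \<in> borel_measurable (augmented_filtration M m \<nu> s)"
  defines "Z \<equiv> \<lambda>\<omega>. (\<Sum>i\<in>I. a i * \<nu> t \<omega> i) - (\<Sum>i\<in>I. a i * \<nu> s \<omega> i)"
  shows "prob_space.indep_var M borel X borel Z"
proof -
  note bmD = std_brownian_motionD[OF bm]
  interpret prob_space M by (rule bmD)
  have Z_meas: "Z \<in> borel_measurable M"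
    unfolding Z_def using I st
    by (intro borel_measurable_diff borel_measurable_sum borel_measurable_times bmD(2)) auto
  define cyl where "cyl = (\<lambda>J B. {\<omega> \<in> space M. \<forall>(i, r)\<in>J. \<nu> r \<omega> i - \<nu> 0 \<omega> i \<in> B (i, r)})"
  define adm where "adm = (\<lambda>(J :: (nat \<times> real) set) (B :: _ \<Rightarrow> real set).
    finite J \<and> J \<subseteq> {1..m} \<times> {0..s} \<and> (\<forall>j\<in>J. B j \<in> sets borel))"
  \<comment> \<open>Agreement up to null sets lets \<open>G\<close> contain the augmenting null
    sets, and lets \<open>\<nu> r\<close> be replaced by \<open>\<nu> r - \<nu> 0\<close>, since the
    start at 0 is only almost sure.\<close>
  define G where "G = {A \<in> events. \<exists>J B. adm J B \<and> (AE \<omega> in M. \<omega> \<in> A \<longleftrightarrow> \<omega> \<in> cyl J B)}"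
  define H where "H = {Z -` D \<inter> space M | D. D \<in> sets borel}"
  have cyl_events: "cyl J B \<in> events" if "adm J B" for J B
    unfolding cyl_def case_prod_beta
  proof (rule sets.sets_Collect_finite_All)
    fix j assume j: "j \<in> J"
    then have "(\<lambda>\<omega>. \<nu> (snd j) \<omega> (fst j) - \<nu> 0 \<omega> (fst j)) \<in> borel_measurable M"
      using that st by (intro borel_measurable_diff bmD(2)) (auto simp: adm_def)
    moreover have "B j \<in> sets borel" using j that by (auto simp: adm_def)
    ultimately show "{\<omega> \<in> space M. \<nu> (snd j) \<omega> (fst j) - \<nu> 0 \<omega> (fst j) \<in> B (fst j, snd j)} \<in> events"
      using measurable_sets by (fastforce simp: vimage_def Int_def conj_commute)
  qed (use that in \<open>auto simp: adm_def\<close>)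
  have G_ev: "G \<subseteq> events" by (auto simp: G_def)
  have H_ev: "H \<subseteq> events" using Z_meas by (auto simp: H_def intro: measurable_sets)
  have "indep_set G H"
  proof (rule indep_setI[OF G_ev H_ev])
    fix A C assume "A \<in> G" "C \<in> H"
    then obtain J B D where *: "A \<in> events" "adm J B" "AE \<omega> in M. \<omega> \<in> A \<longleftrightarrow> \<omega> \<in> cyl J B"
        "C = Z -` D \<inter> space M" "D \<in> sets borel"
      by (auto simp: G_def H_def)
    have C: "C \<in> events" using \<open>C \<in> H\<close> H_ev by auto
    have "prob (A \<inter> C) = prob (cyl J B \<inter> C)"
      using *(1,3) C cyl_events[OF *(2)] by (intro finite_measure_eq_AE) auto
    also have "\<dots> = prob (cyl J B) * prob C"
      unfolding cyl_def *(4) Z_def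
      by (rule bm_cylinder_indep[OF bm I st]) (use * in \<open>auto simp: adm_def\<close>)
    also have "prob (cyl J B) = prob A"
      using *(1,3) cyl_events[OF *(2)] by (intro finite_measure_eq_AE) auto
    finally show "prob (A \<inter> C) = prob A * prob C" .
  qed
  moreover have "Int_stable G"
  proof (rule Int_stableI)
    fix A1 A2 assume "A1 \<in> G" "A2 \<in> G"
    then obtain J1 B1 J2 B2 where *: "A1 \<in> events" "adm J1 B1" "AE \<omega> in M. \<omega> \<in> A1 \<longleftrightarrow> \<omega> \<in> cyl J1 B1"
        "A2 \<in> events" "adm J2 B2" "AE \<omega> in M. \<omega> \<in> A2 \<longleftrightarrow> \<omega> \<in> cyl J2 B2"
      by (auto simp: G_def)
    \<comment> \<open>A constraint absent from one of the two cylinders is read as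
      \<open>UNIV\<close>, so the intersection is a cylinder over the union of the index
      sets.\<close>
    define B where "B = (\<lambda>j. (if j \<in> J1 then B1 j else UNIV) \<inter> (if j \<in> J2 then B2 j else UNIV))"
    have "cyl (J1 \<union> J2) B = cyl J1 B1 \<inter> cyl J2 B2"
      unfolding cyl_def B_def by (auto split: if_splits)
    moreover have "adm (J1 \<union> J2) B" using *(2,5) by (auto simp: adm_def B_def)
    moreover have "AE \<omega> in M. \<omega> \<in> A1 \<inter> A2 \<longleftrightarrow> \<omega> \<in> cyl J1 B1 \<inter> cyl J2 B2"
      using *(3,6) by eventually_elim auto
    ultimately show "A1 \<inter> A2 \<in> G"
      using *(1,4) unfolding G_def by (intro CollectI conjI exI[of _ "J1 \<union> J2"] exI[of _ B]) auto
  qed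
  moreover have "Int_stable H"
  proof (rule Int_stableI)
    fix C1 C2 assume "C1 \<in> H" "C2 \<in> H"
    then obtain D1 D2 where "C1 = Z -` D1 \<inter> space M" "C2 = Z -` D2 \<inter> space M"
        "D1 \<in> sets borel" "D2 \<in> sets borel" by (auto simp: H_def)
    then show "C1 \<inter> C2 \<in> H" unfolding H_def by (intro CollectI exI[of _ "D1 \<inter> D2"]) auto
  qed
  ultimately have ind: "indep_set (sigma_sets (space M) G) (sigma_sets (space M) H)"
    by (rule indep_set_sigma_sets)
  define gen where "gen = filtration_generator M m \<nu> s"
  have gen_G: "gen \<subseteq> G"
  proof
    fix A assume "A \<in> gen"
    then consider (cyl) r i B where "A = (\<lambda>\<omega>. \<nu> r \<omega> i) -` B \<inter> space M" "0 \<le> r" "r \<le> s" "i \<in> {1..m}" "B \<in> sets borel"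
      | (null) "A \<in> null_sets M" by (auto simp: gen_def filtration_generator_def)
    then show "A \<in> G"
    proof cases
      case cyl
      have "AE \<omega> in M. \<nu> 0 \<omega> i = 0" using bmD(5) by eventually_elim (use cyl in auto)
      then have "AE \<omega> in M. \<omega> \<in> A \<longleftrightarrow> \<omega> \<in> cyl {(i, r)} (\<lambda>_. B)"
        using AE_space by eventually_elim (auto simp: cyl_def cyl(1))
      moreover have "adm {(i, r)} (\<lambda>_. B)" using cyl by (auto simp: adm_def)
      moreover have "A \<in> events" unfolding cyl(1) using cyl by (intro measurable_sets[OF bmD(2)]) auto
      ultimately show ?thesis unfolding G_def by blast
    next
      case null
      \<comment> \<open>A null set agrees almost surely with the empty cylinder. With no index the
        cylinder would be the whole space, so the index \<open>(1, 0)\<close> is used, which exists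
        as \<open>1 \<le> m\<close>.\<close>
      define B0 where "B0 = (\<lambda>_::nat \<times> real. {} :: real set)"
      have "adm {(1, 0)} B0" using m st by (auto simp: adm_def B0_def)
      moreover have "AE \<omega> in M. \<omega> \<in> A \<longleftrightarrow> \<omega> \<in> cyl {(1, 0)} B0"
        using AE_not_in[OF null] by eventually_elim (auto simp: cyl_def B0_def)
      ultimately show ?thesis using null unfolding G_def by blast
    qed
  qed
  note sp = space_augmented_filtration[OF bm, of s]
    and se = sets_augmented_filtration[OF bm, of s, folded gen_def]
  have sub: "sigma_sets (space M) gen \<subseteq> sigma_sets (space M) G"
    by (rule sigma_sets_mono') (rule gen_G)
  have X_sets: "X -` A \<inter> space M \<in> sigma_sets (space M) G" if "A \<in> sets borel" for A
    using measurable_sets[OF X that] sub by (auto simp: sp se)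
  have "X \<in> borel_measurable M"
    using X_sets sets.sigma_sets_subset[OF G_ev] by (intro measurableI) auto
  moreover have "indep_set (sigma_sets (space M) {X -` A \<inter> space M |A. A \<in> sets borel})
      (sigma_sets (space M) {Z -` A \<inter> space M |A. A \<in> sets borel})"
  proof -
    have "sigma_sets (space M) {X -` A \<inter> space M |A. A \<in> sets borel} \<subseteq> sigma_sets (space M) G"
      by (rule sigma_sets_mono) (use X_sets in auto)
    then show ?thesis
      using ind unfolding H_def indep_set_def
      by (elim indep_sets_mono_sets) (auto split: bool.split)
  qed
  ultimately show ?thesis using Z_meas by (simp add: indep_var_eq)
qed

section \<open>Projections of the solution\<close>

text \<open>Subtracting the integral equations at \<open>s\<close> and \<open>t\<close> cancels the
  starting point and leaves the drift integral over \<open>(s, t]\<close>. An almost everywhere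
  bound on the combined drift controls it, so the times spent at poles do no harm.\<close>

lemma solution_increment_le:
  fixes D :: "nat \<Rightarrow> real \<Rightarrow> real"
  assumes int: "\<And>t i. 0 \<le> t \<Longrightarrow> i \<in> I \<Longrightarrow> set_integrable lborel {0..t} (D i)"
    and eq: "\<And>t i. 0 \<le> t \<Longrightarrow> i \<in> I \<Longrightarrow> y t i = x i + n t i + (LBINT s:{0..t}. D i s)"
    and st: "0 \<le> s" "s < t" and le: "AE r in lborel. r \<in> {s..t} \<longrightarrow> (\<Sum>i\<in>I. a i * D i r) \<le> c"
  shows "(\<Sum>i\<in>I. a i * y t i) - (\<Sum>i\<in>I. a i * y s i)
    \<le> (\<Sum>i\<in>I. a i * n t i) - (\<Sum>i\<in>I. a i * n s i) + c * (t - s)"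
proof -
  have ist: "set_integrable lborel {s<..t} (D i)" if "i \<in> I" for i
    by (rule set_integrable_subset[OF int[of t, OF _ that]]) (use st in auto)
  have diff: "y t i - y s i = n t i - n s i + (LBINT r:{s<..t}. D i r)" if "i \<in> I" for i
  proof -
    have un: "{0..t} = {0..s} \<union> {s<..t}" using st by auto
    have "(LBINT r:{0..t}. D i r) = (LBINT r:{0..s}. D i r) + (LBINT r:{s<..t}. D i r)"
      unfolding un using int[OF st(1) that] ist[OF that] by (intro set_integral_Un) auto
    then show ?thesis using eq[of t i] eq[of s i] st that by simp
  qed
  have "(\<Sum>i\<in>I. a i * (LBINT r:{s<..t}. D i r)) = (\<Sum>i\<in>I. (LBINT r:{s<..t}. a i * D i r))"
    by simp
  also have "\<dots> = (LBINT r:{s<..t}. (\<Sum>i\<in>I. a i * D i r))"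
    using ist unfolding set_lebesgue_integral_def set_integrable_def
    by (subst Bochner_Integration.integral_sum[symmetric]) (auto simp: sum_distrib_left mult_ac)
  also have "\<dots> \<le> (LBINT r:{s<..t}. c)"
  proof (rule set_integral_mono_AE)
    show "set_integrable lborel {s<..t} (\<lambda>r. \<Sum>i\<in>I. a i * D i r)"
      using ist unfolding set_integrable_def scaleR_sum_right
      by (intro Bochner_Integration.integrable_sum) (auto simp: mult.left_commute)
    show "set_integrable lborel {s<..t} (\<lambda>r. c)"
      using st by (auto simp: set_integrable_def integrable_indicator_iff)
    show "AE r\<in>{s<..t} in lborel. (\<Sum>i\<in>I. a i * D i r) \<le> c"
      using le by eventually_elim auto
  qed
  also have "\<dots> = c * (t - s)" using st by (simp add: set_lebesgue_integral_def)
  finally have "(\<Sum>i\<in>I. a i * (LBINT r:{s<..t}. D i r)) \<le> c * (t - s)" .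
  moreover have "(\<Sum>i\<in>I. a i * y t i) - (\<Sum>i\<in>I. a i * y s i) = (\<Sum>i\<in>I. a i * (y t i - y s i))"
    by (simp add: right_diff_distrib sum_subtractf)
  moreover have "\<dots> = (\<Sum>i\<in>I. a i * (n t i - n s i + (LBINT r:{s<..t}. D i r)))"
    using diff by (intro sum.cong) auto
  moreover have "\<dots> = (\<Sum>i\<in>I. a i * n t i) - (\<Sum>i\<in>I. a i * n s i) + (\<Sum>i\<in>I. a i * (LBINT r:{s<..t}. D i r))"
    by (simp add: algebra_simps sum_subtractf sum.distrib)
  ultimately show ?thesis by linarith
qed

text \<open>The one-dimensional projection behaves like a Bessel process of dimension
  \<open>2 K / \<sigma>\<^sup>2 + 1 < 2\<close>.\<close>

lemma solution_projection_hits_zero: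
  fixes a :: "nat \<Rightarrow> real" and c\<^sub>0 K :: real
  assumes m: "1 \<le> m" and bm: "std_brownian_motion M m \<nu>"
    and sol: "jacobi_strong_solution M m k\<^sub>0 k\<^sub>1 k\<^sub>2 \<nu> x \<phi>"
    and I: "I \<subseteq> {1..m}" "I \<noteq> {}" "\<And>i. i \<in> I \<Longrightarrow> a i \<noteq> 0"
    and range: "\<And>y. y \<in> closed_alcove m \<Longrightarrow> c\<^sub>0 + (\<Sum>i\<in>I. a i * y i) \<in> {0..2}"
    and drift: "\<And>y. y \<in> closed_alcove m \<Longrightarrow> drift_finite m y \<Longrightarrow>
      (\<Sum>i\<in>I. a i * jacobi_drift m k\<^sub>0 k\<^sub>1 k\<^sub>2 y i) \<le> K / (c\<^sub>0 + (\<Sum>i\<in>I. a i * y i))"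
    and K: "0 \<le> K" "2 * K < (\<Sum>i\<in>I. (a i)\<^sup>2)"
  shows "AE \<omega> in M. \<exists>t>0. c\<^sub>0 + (\<Sum>i\<in>I. a i * \<phi> t \<omega> i) = 0"
proof -
  define v where "v = (\<Sum>i\<in>I. (a i)\<^sup>2)"
  \<comment> \<open>This choice makes \<open>S.K = v / 4 + K / 2\<close>, the midpoint between
    \<open>K\<close> and the critical value \<open>v / 2\<close>, which leaves the gap that
    \<open>hits_zero\<close> requires.\<close>
  define \<theta> where "\<theta> = (1 - 2 * K / v) / 4"
  define Y where "Y = (\<lambda>t \<omega>. c\<^sub>0 + (\<Sum>i\<in>I. a i * \<phi> t \<omega> i))"
  define W where "W = (\<lambda>t \<omega>. \<Sum>i\<in>I. a i * \<nu> t \<omega> i)"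
  have v: "0 < v" "2 * K < v" using K by (auto simp: v_def)
  have \<theta>: "0 < \<theta>" "\<theta> < 1 / 2" using v K by (auto simp: \<theta>_def field_simps)
  have solD: "\<And>t i. 0 \<le> t \<Longrightarrow> i \<in> {1..m} \<Longrightarrow>
        (\<lambda>\<omega>. \<phi> t \<omega> i) \<in> borel_measurable (augmented_filtration M m \<nu> t)"
      "AE \<omega> in M. \<forall>i\<in>{1..m}. continuous_on {0..} (\<lambda>t. \<phi> t \<omega> i)"
      "AE \<omega> in M. \<forall>t\<ge>0. \<phi> t \<omega> \<in> closed_alcove m"
      "AE \<omega> in M. AE s in lborel. 0 \<le> s \<longrightarrow> drift_finite m (\<phi> s \<omega>)"
      "AE \<omega> in M. \<forall>t\<ge>0. \<forall>i\<in>{1..m}.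
        set_integrable lborel {0..t} (\<lambda>s. jacobi_drift m k\<^sub>0 k\<^sub>1 k\<^sub>2 (\<phi> s \<omega>) i) \<and>
        \<phi> t \<omega> i = x i + \<nu> t \<omega> i + (LBINT s:{0..t}. jacobi_drift m k\<^sub>0 k\<^sub>1 k\<^sub>2 (\<phi> s \<omega>) i)"
    using sol unfolding jacobi_strong_solution_def by blast+
  interpret prob_space M using bm by (rule std_brownian_motionD)
  interpret S: singular_drift_process M "augmented_filtration M m \<nu>" Y W "sqrt v" \<theta>
  proof unfold_locales
    show "Y t \<in> borel_measurable (augmented_filtration M m \<nu> t)" if "0 \<le> t" for t
      unfolding Y_def using I(1) that
      by (intro borel_measurable_add borel_measurable_sum borel_measurable_times solD(1)) auto
    show "W t \<in> borel_measurable (augmented_filtration M m \<nu> t)" if "0 \<le> t" for t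
      unfolding W_def using I(1) that
      by (intro borel_measurable_sum borel_measurable_times augmented_filtration(3)[OF bm]) auto
    show "indep_var borel X borel (\<lambda>\<omega>. W t \<omega> - W s \<omega>)"
      if "0 \<le> s" "s < t" "X \<in> borel_measurable (augmented_filtration M m \<nu> s)" for s t X
      unfolding W_def by (rule bm_augmented_indep[OF bm m I(1) that])
    show "distributed M lborel (\<lambda>\<omega>. W t \<omega> - W s \<omega>) (normal_density 0 (sqrt v * sqrt (t - s)))"
      if "0 \<le> s" "s < t" for s t
      unfolding W_def v_def by (rule bm_linear_increment_normal[OF bm I that])
  qed (use v \<theta> augmented_filtration[OF bm] in auto)
  have "K < S.K"
  proof -
    have "S.K = v * (1 - 2 * \<theta>) / 2" unfolding S.K_def using v by simp
    also have "\<dots> = v / 4 + K / 2" using v unfolding \<theta>_def by (simp add: field_simps)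
    finally show ?thesis using v by simp
  qed
  then have "AE \<omega> in M. \<exists>t>0. Y t \<omega> = 0"
  proof (rule S.hits_zero[OF K(1)])
    show "AE \<omega> in M. continuous_on {0..} (\<lambda>t. Y t \<omega>)"
      using solD(2)
    proof eventually_elim
      case (elim \<omega>)
      then show ?case unfolding Y_def using I(1) by (intro continuous_intros) auto
    qed
    show "AE \<omega> in M. \<forall>t\<ge>0. Y t \<omega> \<in> {0..2}"
      using solD(3) by eventually_elim (use range in \<open>auto simp: Y_def\<close>)
    show "AE \<omega> in M. \<forall>s t c. 0 < s \<longrightarrow> s < t \<longrightarrow> (\<forall>r\<in>{s..t}. 0 < Y r \<omega> \<and> K / Y r \<omega> \<le> c) \<longrightarrow>
      Y t \<omega> - Y s \<omega> \<le> W t \<omega> - W s \<omega> + c * (t - s)"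
      using solD(3,4,5)
    proof eventually_elim
      case (elim \<omega>)
      show ?case
      proof (intro allI impI)
        fix s t c :: real
        assume st: "0 < s" "s < t" and c: "\<forall>r\<in>{s..t}. 0 < Y r \<omega> \<and> K / Y r \<omega> \<le> c"
        have "AE r in lborel. r \<in> {s..t} \<longrightarrow> (\<Sum>i\<in>I. a i * jacobi_drift m k\<^sub>0 k\<^sub>1 k\<^sub>2 (\<phi> r \<omega>) i) \<le> c"
          using elim(2)
        proof eventually_elim
          case (elim r)
          show ?case
          proof
            assume r: "r \<in> {s..t}"
            have "(\<Sum>i\<in>I. a i * jacobi_drift m k\<^sub>0 k\<^sub>1 k\<^sub>2 (\<phi> r \<omega>) i) \<le> K / Y r \<omega>"
              unfolding Y_def using r st elim \<open>\<forall>t\<ge>0. \<phi> t \<omega> \<in> closed_alcove m\<close> by (intro drift) auto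
            with c r show "(\<Sum>i\<in>I. a i * jacobi_drift m k\<^sub>0 k\<^sub>1 k\<^sub>2 (\<phi> r \<omega>) i) \<le> c" by force
          qed
        qed
        then have "(\<Sum>i\<in>I. a i * \<phi> t \<omega> i) - (\<Sum>i\<in>I. a i * \<phi> s \<omega> i)
            \<le> (\<Sum>i\<in>I. a i * \<nu> t \<omega> i) - (\<Sum>i\<in>I. a i * \<nu> s \<omega> i) + c * (t - s)"
          using st elim(3) I(1)
          by (intro solution_increment_le[where D = "\<lambda>i s. jacobi_drift m k\<^sub>0 k\<^sub>1 k\<^sub>2 (\<phi> s \<omega>) i" and x = x]) auto
        then show "Y t \<omega> - Y s \<omega> \<le> W t \<omega> - W s \<omega> + c * (t - s)"
          by (simp add: Y_def W_def)
      qed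
    qed
  qed
  then show ?thesis by (simp add: Y_def)
qed

section \<open>Finiteness of the three hitting times\<close>

lemma hitting_time_finite:
  assumes "AE \<omega> in M. \<exists>t>0. euclid_inner m \<alpha> (\<phi> t \<omega>) = c"
  shows "AE \<omega> in M. hitting_time m \<phi> \<alpha> c \<omega> < \<infinity>"
  using assms
proof eventually_elim
  case (elim \<omega>)
  then obtain t where "0 < t" "euclid_inner m \<alpha> (\<phi> t \<omega>) = c" by blast
  then have "hitting_time m \<phi> \<alpha> c \<omega> \<le> ereal t"
    unfolding hitting_time_def by (intro INF_lower) auto
  then show ?case by (rule le_less_trans) simp
qed

lemma euclid_inner_unit_vec: "i \<in> {1..m} \<Longrightarrow> euclid_inner m (unit_vec i) y = y i"
  by (simp add: euclid_inner_def unit_vec_def if_distrib[of "\<lambda>u. u * _"] cong: if_cong)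

lemma euclid_inner_diff: "euclid_inner m (\<alpha> - \<beta>) y = euclid_inner m \<alpha> y - euclid_inner m \<beta> y"
  by (simp add: euclid_inner_def left_diff_distrib sum_subtractf)

theorem proposition3p1:
  fixes M :: "'w measure"
    and \<nu> \<phi> :: "real \<Rightarrow> 'w \<Rightarrow> nat \<Rightarrow> real"
    and x :: "nat \<Rightarrow> real"
    and m :: nat
    and \<beta> p q k\<^sub>0 k\<^sub>1 k\<^sub>2 :: real
  assumes "1 \<le> m"
    and "0 < \<beta>"
    and "min p q > (real m - 1) + 1 / \<beta>"
    and "k\<^sub>0 = \<beta> * (p - q) / 2"
    and "k\<^sub>1 = \<beta> * (q - (real m - 1)) - 1"
    and "k\<^sub>2 = \<beta> / 2"
    and "std_brownian_motion M m \<nu>"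
    and "x \<in> closed_alcove m"
    and "jacobi_strong_solution M m k\<^sub>0 k\<^sub>1 k\<^sub>2 \<nu> x \<phi>"
  shows "((0 < \<beta> \<and> \<beta> < 1) \<longleftrightarrow> (0 < k\<^sub>2 \<and> k\<^sub>2 < 1 / 2)) \<and>
         (0 < \<beta> \<and> \<beta> < 1 \<longrightarrow>
            (\<forall>\<alpha>\<in>{unit_vec i - unit_vec (i + 1) | i. 1 \<le> i \<and> i \<le> m - 1}.
               AE \<omega> in M. root_hitting_time m \<phi> \<alpha> \<omega> < \<infinity>)) \<and>
         ((0 < p - (real m - 1) \<and> p - (real m - 1) < 2 / \<beta>) \<longleftrightarrow>
            (0 < 2 * k\<^sub>0 + k\<^sub>1 + 1 \<and> 2 * k\<^sub>0 + k\<^sub>1 + 1 < 2)) \<and>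
         (0 < p - (real m - 1) \<and> p - (real m - 1) < 2 / \<beta> \<longrightarrow>
            (AE \<omega> in M. root_hitting_time m \<phi> (unit_vec m) \<omega> < \<infinity>)) \<and>
         (0 < q - (real m - 1) \<and> q - (real m - 1) < 2 / \<beta> \<longrightarrow>
            (AE \<omega> in M. highest_root_hitting_time m \<phi> \<omega> < \<infinity>))"
proof -
  note \<beta> = assms(2) and bm = assms(7) and sol = assms(9)
  \<comment> \<open>So \<open>p\<close> governs the wall at 0 exactly as \<open>q\<close> governs
    the wall at \<open>pi / 2\<close>, where
    \<open>k\<^sub>1 + 1 = \<beta> * (q - (real m - 1))\<close>. The lower bound on
    \<open>min p q\<close> makes both strengths nonnegative.\<close>
  have sum_k: "2 * k\<^sub>0 + k\<^sub>1 + 1 = \<beta> * (p - (real m - 1))"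
    using assms(4,5) by (simp add: algebra_simps)
  have "1 < \<beta> * (p - (real m - 1))" "1 < \<beta> * (q - (real m - 1))"
    using assms(3) \<beta> by (simp_all add: field_simps)
  then have k: "0 \<le> k\<^sub>1" "0 \<le> 2 * k\<^sub>0 + k\<^sub>1" "0 \<le> k\<^sub>2"
    using sum_k assms(5,6) \<beta> by auto
  have iff: "(0 < z \<and> z < 2 / \<beta>) \<longleftrightarrow> (0 < \<beta> * z \<and> \<beta> * z < 2)" for z
    using \<beta> by (auto simp: field_simps zero_less_mult_iff)
  note hits = solution_projection_hits_zero[OF assms(1) bm sol]
  have pi: "pi / 2 \<le> 2" using pi_less_4 by simp
  have "AE \<omega> in M. root_hitting_time m \<phi> (unit_vec i - unit_vec (i + 1)) \<omega> < \<infinity>"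
    if "\<beta> < 1" "1 \<le> i" "i \<le> m - 1" for i
  proof (rule hitting_time_finite)
    define a where "a = (\<lambda>j. if j = i then 1 else - 1 :: real)"
    have a: "(\<Sum>j\<in>{i, i + 1}. a j * f j) = f i - f (i + 1)" for f by (simp add: a_def)
    have im: "i \<in> {1..m}" "i + 1 \<in> {1..m}" using that by auto
    \<comment> \<open>The gap has noise variance 2 and drift constant
      \<open>2 * k\<^sub>2 = \<beta>\<close>, so the subcriticality condition
      \<open>2 * K < 2\<close> is \<open>\<beta> < 1\<close>.\<close>
    have "AE \<omega> in M. \<exists>t>0. 0 + (\<Sum>j\<in>{i, i + 1}. a j * \<phi> t \<omega> j) = 0"
    proof (rule hits[where K = "2 * k\<^sub>2"])
      show "0 + (\<Sum>j\<in>{i, i + 1}. a j * y j) \<in> {0..2}" if "y \<in> closed_alcove m" for y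
      proof -
        have "0 \<le> y (i + 1)" "y i \<le> pi / 2" "y (i + 1) \<le> y i"
          using that im unfolding closed_alcove_def by auto
        then show ?thesis using pi unfolding a by simp
      qed
      show "(\<Sum>j\<in>{i, i + 1}. a j * jacobi_drift m k\<^sub>0 k\<^sub>1 k\<^sub>2 y j) \<le> 2 * k\<^sub>2 / (0 + (\<Sum>j\<in>{i, i + 1}. a j * y j))"
        if "y \<in> closed_alcove m" "drift_finite m y" for y
        unfolding a using drift_gap_le[OF that _ _ k, of i] im by simp
    qed (use im k \<open>\<beta> < 1\<close> assms(6) in \<open>auto simp: a_def\<close>)
    then show "AE \<omega> in M. \<exists>t>0. euclid_inner m (unit_vec i - unit_vec (i + 1)) (\<phi> t \<omega>) = 0"
      unfolding a using im by (simp add: euclid_inner_diff euclid_inner_unit_vec)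
  qed
  moreover have "AE \<omega> in M. root_hitting_time m \<phi> (unit_vec m) \<omega> < \<infinity>"
    if "2 * k\<^sub>0 + k\<^sub>1 + 1 < 2"
  proof (rule hitting_time_finite)
    \<comment> \<open>With unit variance, \<open>2 * K < 1\<close> reads
      \<open>2 * k\<^sub>0 + k\<^sub>1 < 1\<close>.\<close>
    have "AE \<omega> in M. \<exists>t>0. 0 + (\<Sum>j\<in>{m}. 1 * \<phi> t \<omega> j) = 0"
    proof (rule hits[where K = "k\<^sub>0 + k\<^sub>1 / 2"])
      show "0 + (\<Sum>j\<in>{m}. 1 * y j) \<in> {0..2}" if "y \<in> closed_alcove m" for y
      proof -
        have "0 \<le> y m" "y m \<le> pi / 2" using that assms(1) unfolding closed_alcove_def by auto
        then show ?thesis using pi by simp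
      qed
      show "(\<Sum>j\<in>{m}. 1 * jacobi_drift m k\<^sub>0 k\<^sub>1 k\<^sub>2 y j) \<le> (k\<^sub>0 + k\<^sub>1 / 2) / (0 + (\<Sum>j\<in>{m}. 1 * y j))"
        if "y \<in> closed_alcove m" "drift_finite m y" for y
        using drift_last_le[OF that assms(1) k] by simp
    qed (use assms(1) k that in auto)
    then show "AE \<omega> in M. \<exists>t>0. euclid_inner m (unit_vec m) (\<phi> t \<omega>) = 0"
      using assms(1) by (simp add: euclid_inner_unit_vec)
  qed
  moreover have "AE \<omega> in M. highest_root_hitting_time m \<phi> \<omega> < \<infinity>"
    if "k\<^sub>1 + 1 < 2"
  proof (rule hitting_time_finite)
    \<comment> \<open>The process is the distance \<open>pi / 2 - \<phi>\<^sub>1\<close> to the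
      upper wall. With unit variance, \<open>2 * K < 1\<close> reads \<open>k\<^sub>1 < 1\<close>,
      that is, \<open>q - (real m - 1) < 2 / \<beta>\<close>.\<close>
    have "AE \<omega> in M. \<exists>t>0. pi / 2 + (\<Sum>j\<in>{1::nat}. - 1 * \<phi> t \<omega> j) = 0"
    proof (rule hits[where K = "k\<^sub>1 / 2"])
      show "pi / 2 + (\<Sum>j\<in>{1::nat}. - 1 * y j) \<in> {0..2}" if "y \<in> closed_alcove m" for y
      proof -
        have "0 \<le> y 1" "y 1 \<le> pi / 2" using that assms(1) unfolding closed_alcove_def by auto
        then show ?thesis using pi by simp
      qed
      show "(\<Sum>j\<in>{1::nat}. - 1 * jacobi_drift m k\<^sub>0 k\<^sub>1 k\<^sub>2 y j) \<le> k\<^sub>1 / 2 / (pi / 2 + (\<Sum>j\<in>{1::nat}. - 1 * y j))"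
        if "y \<in> closed_alcove m" "drift_finite m y" for y
        using minus_drift_first_le[OF that assms(1) k] by simp
    qed (use assms(1) k that in auto)
    moreover have "euclid_inner m (\<lambda>j. 2 * unit_vec 1 j) y = 2 * y 1" for y
      using euclid_inner_unit_vec[of 1 m y] assms(1)
      by (simp add: euclid_inner_def mult.assoc flip: sum_distrib_left)
    ultimately show "AE \<omega> in M. \<exists>t>0. euclid_inner m (\<lambda>j. 2 * unit_vec 1 j) (\<phi> t \<omega>) = pi"
      by (simp add: field_simps eq_commute[of pi])
  qed
  ultimately show ?thesis
    unfolding iff sum_k[symmetric] using \<beta> assms(5,6) by auto
qed

end
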